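(* Let $m,n,l\ge 1$ be integers, let $\beta>0$ be real, and let $s\in\{-1,1\}$. Let $\mathcal{X}=\{\mathbf{x}^{(1)},\mathbf{x}^{(2)},\dots,\mathbf{x}^{(l)}\}$, where $\mathbf{x}^{(i)}\in S^{n-1}$ for $1\le i\le l$ and $S^{n-1}$ is the unit Euclidean sphere in $\mathbb{R}^n$. Let $G$ be an $m\times n$ matrix of i.i.d. standard normals, $\mathbf{u}^{(2)}$ an $m\times 1$ vector of i.i.d. standard normals, and $\mathbf{h}$ an $n\times 1$ vector of i.i.d. standard normals, with $G$, $\mathbf{u}^{(2)}$, $\mathbf{h}$ independent of each other. Then the function $$\psi(\mathcal{X},\beta,s,t)=\mathbb{E}_{G,\mathbf{u}^{(2)},\mathbf{h}}\,\frac{1}{\beta\sqrt{n}}\log\left(\sum_{i=1}^{l}e^{\beta\left(s\|\sqrt{t}\,G\mathbf{x}^{(i)}+\sqrt{1-t}\,\mathbf{u}^{(2)}\|_2+\sqrt{1-t}\,\mathbf{h}^T\mathbf{x}^{(i)}\right)}\right),\qquad t\in[0,1],$$ is decreasing in $t$.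
   Context: $\|\cdot\|_2$ is the Euclidean norm and $\mathbb{E}$ denotes expectation over the indicated random variables. "Decreasing" is meant in the non-strict sense: $\psi(\mathcal{X},\beta,s,t_1)\ge\psi(\mathcal{X},\beta,s,t_2)$ whenever $0\le t_1\le t_2\le 1$. *)

theory Defs
  imports "HOL-Probability.Probability"
begin

definition iid_std_normal :: "'w measure \<Rightarrow> ('i \<Rightarrow> 'w \<Rightarrow> real) \<Rightarrow> 'i set \<Rightarrow> bool" where
  "iid_std_normal M X I \<longleftrightarrow>
     prob_space.indep_vars M (\<lambda>_. borel) X I \<and>
     (\<forall>i\<in>I. distributed M lborel (X i) std_normal_density)"

definition generated_events :: "'w measure \<Rightarrow> ('w \<Rightarrow> 'a::topological_space) \<Rightarrow> 'w set set" where
  "generated_events M X = {X -` A \<inter> space M | A. A \<in> sets borel}"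

(* Mutual independence of three random variables whose value types may differ;
   indep_vars requires one common value type. *)
definition indep_three ::
  "'w measure \<Rightarrow> ('w \<Rightarrow> 'a::topological_space) \<Rightarrow> ('w \<Rightarrow> 'b::topological_space)
     \<Rightarrow> ('w \<Rightarrow> 'c::topological_space) \<Rightarrow> bool" where
  "indep_three M X Y Z \<longleftrightarrow>
     X \<in> borel_measurable M \<and> Y \<in> borel_measurable M \<and> Z \<in> borel_measurable M \<and>
     prob_space.indep_sets M
       (\<lambda>k. [generated_events M X, generated_events M Y, generated_events M Z] ! k) {..<3}"

(* G, u, h are random variables on M; the dimensions m and n are CARD('m) and CARD('n). *)
definition psi ::
  "'w measure \<Rightarrow> ('w \<Rightarrow> real ^ 'n ^ 'm) \<Rightarrow> ('w \<Rightarrow> real ^ 'm) \<Rightarrow> ('w \<Rightarrow> real ^ 'n)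
     \<Rightarrow> nat \<Rightarrow> (nat \<Rightarrow> real ^ 'n) \<Rightarrow> real \<Rightarrow> real \<Rightarrow> real \<Rightarrow> real" where
  "psi M G u h l x \<beta> s t =
     prob_space.expectation M (\<lambda>\<omega>.
       1 / (\<beta> * sqrt (real CARD('n))) *
       ln (\<Sum>i=1..l. exp (\<beta> *
         (s * norm (sqrt t *\<^sub>R (G \<omega> *v x i) + sqrt (1 - t) *\<^sub>R u \<omega>)
          + sqrt (1 - t) * (h \<omega> \<bullet> x i)))))"

end

theory Submission
  imports Defs
begin

text \<open>
  Put \<open>t = (sin \<theta>)\<^sup>2\<close> with \<open>0 \<le> \<theta> \<le> pi/2\<close> and let \<open>Z = (G, u, h)\<close>, which by independence is a
  standard Gaussian vector of a product space. Write \<open>a\<^sub>i = sin \<theta> G x\<^sub>i + cos \<theta> u\<close>,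
  \<open>b\<^sub>i = cos \<theta> h \<bullet> x\<^sub>i\<close> and \<open>w\<^sub>i = s \<parallel>a\<^sub>i\<parallel> + b\<^sub>i\<close>. Up to the factor \<open>sqrt n\<close> the function in question is
  the expectation of \<open>L(w) = (1/\<beta>) log (\<Sum>\<^sub>i exp (\<beta> w\<^sub>i))\<close>. Let \<open>p\<^sub>i\<close> be the softmax weights of \<open>w\<close> and \<open>g\<^sub>i\<close> the
  gradient of the norm at \<open>a\<^sub>i\<close>. Then the derivative of \<open>E L(w)\<close> in \<open>\<theta>\<close> is

    \<open>E \<Sum>\<^sub>i p\<^sub>i (s g\<^sub>i \<bullet> (cos \<theta> G x\<^sub>i - sin \<theta> u) - sin \<theta> h \<bullet> x\<^sub>i)\<close>.

  Every term is a linear form in \<open>Z\<close> times a bounded function of \<open>Z\<close>, so Gaussian integration by parts,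
  \<open>E ((Z \<bullet> c) H(Z)) = E (H'(Z) c)\<close> (lemma \<open>stein\<close>), trades the linear form for a directional derivative.
  The direction \<open>c\<close> belonging to the k-th coordinate of \<open>cos \<theta> G x\<^sub>i - sin \<theta> u\<close> moves \<open>a\<^sub>j\<close> by
  \<open>sin \<theta> cos \<theta> (x\<^sub>i \<bullet> x\<^sub>j - 1) e\<^sub>k\<close>. For \<open>j = i\<close> this is zero because \<open>x\<^sub>i\<close> is a unit vector; so \<open>g\<^sub>i\<close> is
  constant along \<open>c\<close>, the second derivative of the norm does not contribute, and only the weights get
  differentiated. Collecting terms with \<open>\<Sum>\<^sub>j p\<^sub>j = 1\<close> and \<open>s\<^sup>2 = 1\<close>, the derivative becomes

    \<open>- \<beta> sin \<theta> cos \<theta> E \<Sum>\<^sub>i \<Sum>\<^sub>j p\<^sub>i p\<^sub>j (1 - x\<^sub>i \<bullet> x\<^sub>j) (1 - g\<^sub>i \<bullet> g\<^sub>j) \<le> 0\<close>,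

  as all \<open>x\<^sub>i\<close> and \<open>g\<^sub>i\<close> lie in the closed unit ball (lemma \<open>interp_drift_nonpos\<close>).

  The norm is not differentiable at the origin. The computation is therefore done with
  \<open>sqrt (\<epsilon>\<^sup>2 + \<parallel>a\<parallel>\<^sup>2)\<close>, whose gradient still has norm at most 1 (lemma \<open>smooth_interp_antimono\<close>). It differs
  from the norm by at most \<open>\<epsilon>\<close>, hence so does the expectation, and letting \<open>\<epsilon>\<close> tend to 0 gives the result
  (lemma \<open>interp_antimono\<close>). The parameter \<open>\<theta>\<close> is used instead of \<open>t\<close> because \<open>sqrt t\<close> is not
  differentiable at 0 and \<open>sqrt (1 - t)\<close> not at 1.
\<close>

section \<open>Gaussian integration by parts\<close>

lemma std_normal_density_has_real_derivative:
  "(std_normal_density has_real_derivative - x * std_normal_density x) (at x)"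
  unfolding std_normal_density_def
  by (auto intro!: derivative_eq_intros simp: field_simps)

lemma std_normal_density_tendsto_0:
  "(std_normal_density \<longlongrightarrow> 0) at_top" "(std_normal_density \<longlongrightarrow> 0) at_bot"
  unfolding std_normal_density_def by real_asymp+

text \<open>The density satisfies \<open>\<phi>'(x) = - x \<phi>(x)\<close>, so \<open>f' \<phi> - x f \<phi>\<close> is the derivative of
  \<open>f \<phi>\<close>, which tends to zero at both infinities.\<close>

lemma stein_real:
  fixes f f' :: "real \<Rightarrow> real"
  assumes deriv: "\<And>x. (f has_real_derivative f' x) (at x)"
    and cont: "continuous_on UNIV f'"
    and bnd: "\<And>x. \<bar>f x\<bar> \<le> B" "\<And>x. \<bar>f' x\<bar> \<le> B'"
  shows "(\<integral>x. x * f x \<partial>density lborel std_normal_density) = (\<integral>x. f' x \<partial>density lborel std_normal_density)"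
proof -
  have cf: "continuous_on UNIV f"
    using deriv DERIV_isCont continuous_at_imp_continuous_on by blast
  have [measurable]: "f \<in> borel_measurable borel" "f' \<in> borel_measurable borel"
    using cf cont by (auto intro: borel_measurable_continuous_onI)
  have i0: "integrable lborel std_normal_density" by simp
  have i1: "integrable lborel (\<lambda>x. std_normal_density x * x)"
    using integrable_normal_moment_nz_1[of 1 0] by simp
  have int1: "integrable lborel (\<lambda>x. f' x * std_normal_density x)"
    by (rule Bochner_Integration.integrable_bound[OF integrable_mult_right[OF i0, of B']])
       (use bnd(2) in \<open>auto intro!: AE_I2 mult_right_mono order_trans[OF _ abs_ge_self] simp: abs_mult\<close>)
  have int2: "integrable lborel (\<lambda>x. std_normal_density x * (x * f x))"
  proof (rule Bochner_Integration.integrable_bound[OF integrable_mult_right[OF i1, of B]])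
    have "\<bar>std_normal_density x * (x * f x)\<bar> \<le> \<bar>B * (std_normal_density x * x)\<bar>" for x
      using mult_left_mono[OF order_trans[OF bnd(1)[of x] abs_ge_self], of "\<bar>std_normal_density x * x\<bar>"]
      by (simp add: abs_mult ac_simps)
    then show "AE x in lborel. norm (std_normal_density x * (x * f x)) \<le> norm (B * (std_normal_density x * x))"
      by simp
  qed measurable
  have lim: "((\<lambda>x. f x * std_normal_density x) \<longlongrightarrow> 0) F" if "(std_normal_density \<longlongrightarrow> 0) F" for F
    by (rule Lim_null_comparison[OF _ tendsto_mult_right_zero[OF that, of B]])
       (use bnd(1) in \<open>auto intro!: always_eventually mult_right_mono simp: abs_mult\<close>)
  let ?d = "\<lambda>x. f' x * std_normal_density x - std_normal_density x * (x * f x)"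
  have "(LBINT x=-\<infinity>..\<infinity>. ?d x) = 0 - 0"
  proof (rule interval_integral_FTC_integrable)
    fix x :: real
    show "((\<lambda>x. f x * std_normal_density x) has_vector_derivative ?d x) (at x)"
      by (auto intro!: derivative_eq_intros deriv std_normal_density_has_real_derivative
          simp flip: has_real_derivative_iff_has_vector_derivative simp: algebra_simps)
    have "continuous_on UNIV ?d"
      unfolding std_normal_density_def by (intro continuous_intros cont cf) auto
    then show "isCont ?d x" by (simp add: continuous_on_eq_continuous_at)
  next
    show "set_integrable lborel (einterval (-\<infinity>) \<infinity>) ?d"
      using int1 int2 by (simp add: einterval_iff[abs_def] set_integrable_def)
  next
    show "(((\<lambda>x. f x * std_normal_density x) \<circ> real_of_ereal) \<longlongrightarrow> 0) (at_right (-\<infinity>))"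
      by (simp add: ereal_tendsto_simps lim std_normal_density_tendsto_0)
    show "(((\<lambda>x. f x * std_normal_density x) \<circ> real_of_ereal) \<longlongrightarrow> 0) (at_left \<infinity>)"
      by (simp add: ereal_tendsto_simps lim std_normal_density_tendsto_0)
  qed simp
  then have "(\<integral>x. ?d x \<partial>lborel) = 0"
    by (simp add: interval_lebesgue_integral_def set_lebesgue_integral_def)
  then show ?thesis
    using int1 int2 by (simp add: integral_density mult.commute)
qed

text \<open>Coordinates with respect to the standard basis make the notion available for matrices and for
  tuples of vectors alike.\<close>

definition std_gaussian :: "'w measure \<Rightarrow> ('w \<Rightarrow> 'a::euclidean_space) \<Rightarrow> bool" where
  "std_gaussian M Z \<longleftrightarrow> prob_space M \<and> iid_std_normal M (\<lambda>b \<omega>. Z \<omega> \<bullet> b) Basis"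

lemma std_gaussian_measurable:
  fixes Z :: "'w \<Rightarrow> 'a::euclidean_space"
  assumes "std_gaussian M Z"
  shows "Z \<in> borel_measurable M"
proof (subst borel_measurable_euclidean_space, intro ballI)
  fix b :: 'a assume "b \<in> Basis"
  then have "distributed M lborel (\<lambda>\<omega>. Z \<omega> \<bullet> b) std_normal_density"
    using assms by (auto simp: std_gaussian_def iid_std_normal_def)
  then show "(\<lambda>\<omega>. Z \<omega> \<bullet> b) \<in> borel_measurable M"
    by (auto dest: distributed_measurable)
qed

text \<open>The bridge from random vectors to product measures, on which Fubini's theorem isolates one coordinate.\<close>

lemma std_gaussian_law:
  fixes Z :: "'w \<Rightarrow> 'a::euclidean_space"
  assumes "std_gaussian M Z"
  shows "distr M (\<Pi>\<^sub>M b\<in>Basis. borel) (\<lambda>\<omega>. \<lambda>b\<in>Basis. Z \<omega> \<bullet> b) = (\<Pi>\<^sub>M b\<in>Basis. std_normal_distribution)"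
proof -
  interpret prob_space M using assms by (simp add: std_gaussian_def)
  note [measurable] = std_gaussian_measurable[OF assms]
  have "distr M borel (\<lambda>\<omega>. Z \<omega> \<bullet> b) = std_normal_distribution" if "b \<in> Basis" for b
  proof -
    have "distr M borel (\<lambda>\<omega>. Z \<omega> \<bullet> b) = distr M lborel (\<lambda>\<omega>. Z \<omega> \<bullet> b)"
      by (rule distr_cong) auto
    also have "\<dots> = std_normal_distribution"
      using assms that by (auto simp: std_gaussian_def iid_std_normal_def dest: distributed_distr_eq_density)
    finally show ?thesis .
  qed
  moreover have "indep_vars (\<lambda>_. borel) (\<lambda>b \<omega>. Z \<omega> \<bullet> b) Basis"
    using assms by (simp add: std_gaussian_def iid_std_normal_def)
  ultimately show ?thesis
    by (subst (asm) indep_vars_iff_distr_eq_PiM') (auto cong: PiM_cong)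
qed

lemma std_gaussian_expectation:
  fixes Z :: "'w \<Rightarrow> 'a::euclidean_space" and g :: "'a \<Rightarrow> real"
  assumes Z: "std_gaussian M Z" and [measurable]: "g \<in> borel_measurable borel"
  shows "(\<integral>\<omega>. g (Z \<omega>) \<partial>M) = (\<integral>f. g (\<Sum>b\<in>Basis. f b *\<^sub>R b) \<partial>(\<Pi>\<^sub>M b\<in>Basis. std_normal_distribution))"
    and "integrable M (\<lambda>\<omega>. g (Z \<omega>)) \<longleftrightarrow>
      integrable (\<Pi>\<^sub>M b\<in>Basis. std_normal_distribution) (\<lambda>f. g (\<Sum>b\<in>Basis. f b *\<^sub>R b))"
proof -
  note [measurable] = std_gaussian_measurable[OF Z]
  let ?P = "\<Pi>\<^sub>M b\<in>(Basis :: 'a set). (borel :: real measure)"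
  have m: "(\<lambda>\<omega>. \<lambda>b\<in>Basis. Z \<omega> \<bullet> b) \<in> measurable M ?P" by measurable
  have mg: "(\<lambda>f. g (\<Sum>b\<in>Basis. f b *\<^sub>R b)) \<in> borel_measurable ?P" by measurable
  have eq: "g (\<Sum>b\<in>Basis. (\<lambda>b\<in>Basis. Z \<omega> \<bullet> b) b *\<^sub>R b) = g (Z \<omega>)" for \<omega>
    by (simp add: euclidean_representation)
  show "(\<integral>\<omega>. g (Z \<omega>) \<partial>M) = (\<integral>f. g (\<Sum>b\<in>Basis. f b *\<^sub>R b) \<partial>(\<Pi>\<^sub>M b\<in>Basis. std_normal_distribution))"
    unfolding std_gaussian_law[OF Z, symmetric] integral_distr[OF m mg] eq ..
  show "integrable M (\<lambda>\<omega>. g (Z \<omega>)) \<longleftrightarrow>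
      integrable (\<Pi>\<^sub>M b\<in>Basis. std_normal_distribution) (\<lambda>f. g (\<Sum>b\<in>Basis. f b *\<^sub>R b))"
    unfolding std_gaussian_law[OF Z, symmetric] integrable_distr_eq[OF m mg] eq ..
qed

lemma std_gaussian_integrable_norm:
  fixes Z :: "'w \<Rightarrow> 'a::euclidean_space"
  assumes Z: "std_gaussian M Z"
  shows "integrable M (\<lambda>\<omega>. norm (Z \<omega>))"
proof (rule Bochner_Integration.integrable_bound)
  note [measurable] = std_gaussian_measurable[OF Z]
  show "integrable M (\<lambda>\<omega>. \<Sum>b\<in>Basis. \<bar>Z \<omega> \<bullet> b\<bar>)"
  proof (intro Bochner_Integration.integrable_sum integrable_abs)
    fix b :: 'a assume b: "b \<in> Basis"
    have "distributed M lborel (\<lambda>\<omega>. Z \<omega> \<bullet> b) std_normal_density"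
      using Z b by (auto simp: std_gaussian_def iid_std_normal_def)
    from distributed_integrable[OF this, of "\<lambda>x. x"]
    show "integrable M (\<lambda>\<omega>. Z \<omega> \<bullet> b)"
      using integrable_normal_moment_nz_1[of 1 0] by simp
  qed
  show "AE \<omega> in M. norm (norm (Z \<omega>)) \<le> norm (\<Sum>b\<in>Basis. \<bar>Z \<omega> \<bullet> b\<bar>)"
    by (auto simp: norm_le_l1 intro!: order_trans[OF _ abs_ge_self])
qed (measurable, rule std_gaussian_measurable[OF Z])

lemma std_gaussian_integrable_linear_growth:
  fixes Z :: "'w \<Rightarrow> 'a::euclidean_space" and f :: "'a \<Rightarrow> real"
  assumes Z: "std_gaussian M Z" and [measurable]: "f \<in> borel_measurable borel"
    and f: "\<And>z. \<bar>f z\<bar> \<le> C + K * norm z"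
  shows "integrable M (\<lambda>\<omega>. f (Z \<omega>))"
proof (rule Bochner_Integration.integrable_bound)
  note [measurable] = std_gaussian_measurable[OF Z]
  interpret prob_space M using Z by (simp add: std_gaussian_def)
  show "integrable M (\<lambda>\<omega>. C + K * norm (Z \<omega>))"
    using std_gaussian_integrable_norm[OF Z] by auto
  show "AE \<omega> in M. norm (f (Z \<omega>)) \<le> norm (C + K * norm (Z \<omega>))"
    by (auto intro!: order_trans[OF f abs_ge_self])
qed (measurable, rule std_gaussian_measurable[OF Z])

lemma std_gaussian_integrable_norm_linear:
  fixes Z :: "'w \<Rightarrow> 'a::euclidean_space" and f :: "'a \<Rightarrow> 'b::euclidean_space"
  assumes "std_gaussian M Z" and f: "bounded_linear f"
  shows "integrable M (\<lambda>\<omega>. norm (f (Z \<omega>)))"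
proof (rule std_gaussian_integrable_linear_growth[OF assms(1), of _ 0 "onorm f"])
  show "(\<lambda>z. norm (f z)) \<in> borel_measurable borel"
    by (intro borel_measurable_continuous_onI continuous_intros bounded_linear.continuous_on[OF f])
qed (use onorm[OF f] in auto)

text \<open>Fubini reduces the claim to \<open>stein_real\<close> on each line parallel to b, the other coordinates being held fixed.\<close>

lemma stein_basis:
  fixes Z :: "'w \<Rightarrow> 'a::euclidean_space" and H :: "'a \<Rightarrow> real"
  assumes Z: "std_gaussian M Z" and b: "b \<in> Basis"
    and deriv: "\<And>z. (H has_derivative H' z) (at z)"
    and cont: "continuous_on UNIV (\<lambda>z. H' z b)"
    and bnd: "\<And>z. \<bar>H z\<bar> \<le> B" "\<And>z. \<bar>H' z b\<bar> \<le> B'"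
  shows "(\<integral>\<omega>. (Z \<omega> \<bullet> b) * H (Z \<omega>) \<partial>M) = (\<integral>\<omega>. H' (Z \<omega>) b \<partial>M)"
proof -
  let ?N = "\<lambda>_::'a. std_normal_distribution"
  let ?v = "\<lambda>f. \<Sum>b\<in>Basis. f b *\<^sub>R b :: 'a"
  interpret product_sigma_finite ?N
    by (intro product_sigma_finite.intro prob_space_imp_sigma_finite prob_space_normal_density) auto
  have cH: "continuous_on UNIV H"
    using deriv has_derivative_continuous continuous_at_imp_continuous_on by blast
  have [measurable]: "H \<in> borel_measurable borel" "(\<lambda>z. H' z b) \<in> borel_measurable borel"
    using cH cont by (auto intro: borel_measurable_continuous_onI)
  have B: "B \<ge> 0" using bnd(1)[of 0] by simp
  have i1: "integrable M (\<lambda>\<omega>. (Z \<omega> \<bullet> b) * H (Z \<omega>))"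
    by (rule std_gaussian_integrable_linear_growth[OF Z, of _ 0 B])
       (use bnd(1) b B in \<open>auto simp: abs_mult mult.commute intro!: mult_mono Basis_le_norm\<close>)
  have i2: "integrable M (\<lambda>\<omega>. H' (Z \<omega>) b)"
    by (rule std_gaussian_integrable_linear_growth[OF Z, of _ B' 0]) (use bnd(2) in auto)
  define w where "w = (\<lambda>f. ?v (f(b := 0)))"
  have line: "?v (f(b := r)) = w f + r *\<^sub>R b" for f r
    unfolding w_def using b by (simp add: sum.remove[of _ b] add.commute)
  \<comment> \<open>Conditionally on all coordinates but b, this is the one-dimensional statement.\<close>
  have inner: "(\<integral>r. (?v (f(b := r)) \<bullet> b) * H (?v (f(b := r))) \<partial>std_normal_distribution)
      = (\<integral>r. H' (?v (f(b := r))) b \<partial>std_normal_distribution)" for f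
  proof -
    have "?v (f(b := r)) \<bullet> b = r" for r
      using b by (simp add: inner_sum_left_Basis)
    moreover have "(\<integral>r. r * H (w f + r *\<^sub>R b) \<partial>std_normal_distribution)
      = (\<integral>r. H' (w f + r *\<^sub>R b) b \<partial>std_normal_distribution)"
    proof (rule stein_real[OF _ _ bnd])
      fix r :: real
      let ?z = "w f + r *\<^sub>R b"
      have "((\<lambda>r. H (w f + r *\<^sub>R b)) has_derivative (\<lambda>t. H' ?z (t *\<^sub>R b))) (at r)"
        by (rule has_derivative_compose[OF _ deriv]) (auto intro!: derivative_eq_intros)
      moreover have "(\<lambda>t. H' ?z (t *\<^sub>R b)) = (*) (H' ?z b)"
        using has_derivative_linear[OF deriv, of ?z] by (auto simp: linear_scale)
      ultimately show "((\<lambda>r. H (w f + r *\<^sub>R b)) has_real_derivative H' ?z b) (at r)"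
        by (simp only: has_field_derivative_def)
    next
      show "continuous_on UNIV (\<lambda>r. H' (w f + r *\<^sub>R b) b)"
        by (rule continuous_on_compose2[OF cont]) (auto intro!: continuous_intros)
    qed
    ultimately show ?thesis by (simp only: line)
  qed
  have ins: "insert b (Basis - {b}) = Basis" using b by auto
  have "(\<integral>\<omega>. (Z \<omega> \<bullet> b) * H (Z \<omega>) \<partial>M) = (\<integral>f. (?v f \<bullet> b) * H (?v f) \<partial>Pi\<^sub>M (insert b (Basis - {b})) ?N)"
    unfolding ins by (rule std_gaussian_expectation[OF Z]) measurable
  also have "\<dots> = (\<integral>f. \<integral>r. (?v (f(b := r)) \<bullet> b) * H (?v (f(b := r))) \<partial>std_normal_distribution \<partial>Pi\<^sub>M (Basis - {b}) ?N)"
    by (rule product_integral_insert, simp, simp, unfold ins,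
        rule std_gaussian_expectation(2)[OF Z, THEN iffD1, OF _ i1]) measurable
  also have "\<dots> = (\<integral>f. \<integral>r. H' (?v (f(b := r))) b \<partial>std_normal_distribution \<partial>Pi\<^sub>M (Basis - {b}) ?N)"
    unfolding inner ..
  also have "\<dots> = (\<integral>f. H' (?v f) b \<partial>Pi\<^sub>M (insert b (Basis - {b})) ?N)"
    by (rule product_integral_insert[symmetric], simp, simp, unfold ins,
        rule std_gaussian_expectation(2)[OF Z, THEN iffD1, OF _ i2]) measurable
  also have "\<dots> = (\<integral>\<omega>. H' (Z \<omega>) b \<partial>M)"
    unfolding ins by (rule std_gaussian_expectation[OF Z, symmetric]) measurable
  finally show ?thesis .
qed

text \<open>Both sides are linear in the direction c, so it suffices to sum the basis directions.\<close>

lemma stein: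
  fixes Z :: "'w \<Rightarrow> 'a::euclidean_space" and H :: "'a \<Rightarrow> real"
  assumes Z: "std_gaussian M Z"
    and deriv: "\<And>z. (H has_derivative H' z) (at z)"
    and cont: "\<And>c. continuous_on UNIV (\<lambda>z. H' z c)"
    and bnd: "\<And>z. \<bar>H z\<bar> \<le> B" "\<And>z c. \<bar>H' z c\<bar> \<le> B' * norm c"
  shows "integrable M (\<lambda>\<omega>. (Z \<omega> \<bullet> c) * H (Z \<omega>))"
    and "integrable M (\<lambda>\<omega>. H' (Z \<omega>) c)"
    and "(\<integral>\<omega>. (Z \<omega> \<bullet> c) * H (Z \<omega>) \<partial>M) = (\<integral>\<omega>. H' (Z \<omega>) c \<partial>M)"
proof -
  have cH: "continuous_on UNIV H"
    using deriv has_derivative_continuous continuous_at_imp_continuous_on by blast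
  have [measurable]: "H \<in> borel_measurable borel" "\<And>c. (\<lambda>z. H' z c) \<in> borel_measurable borel"
    using cH cont by (auto intro: borel_measurable_continuous_onI)
  have B: "B \<ge> 0" using bnd(1)[of 0] by simp
  have i1: "integrable M (\<lambda>\<omega>. (Z \<omega> \<bullet> c) * H (Z \<omega>))" for c
  proof (rule std_gaussian_integrable_linear_growth[OF Z, of _ 0 "norm c * B"])
    fix z
    have "\<bar>(z \<bullet> c) * H z\<bar> \<le> (norm z * norm c) * B"
      unfolding abs_mult using bnd(1)[of z] B
      by (intro mult_mono Cauchy_Schwarz_ineq2) auto
    then show "\<bar>(z \<bullet> c) * H z\<bar> \<le> 0 + norm c * B * norm z" by (simp add: ac_simps)
  qed measurable
  have i2: "integrable M (\<lambda>\<omega>. H' (Z \<omega>) c)" for c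
    by (rule std_gaussian_integrable_linear_growth[OF Z, of _ "B' * norm c" 0]) (use bnd(2) in auto)
  show "integrable M (\<lambda>\<omega>. (Z \<omega> \<bullet> c) * H (Z \<omega>))" "integrable M (\<lambda>\<omega>. H' (Z \<omega>) c)"
    by (rule i1 i2)+
  have "(\<integral>\<omega>. (Z \<omega> \<bullet> c) * H (Z \<omega>) \<partial>M)
      = (\<integral>\<omega>. (\<Sum>b\<in>Basis. (c \<bullet> b) * ((Z \<omega> \<bullet> b) * H (Z \<omega>))) \<partial>M)"
    by (subst euclidean_inner) (simp add: sum_distrib_left sum_distrib_right ac_simps)
  also have "\<dots> = (\<Sum>b\<in>Basis. (c \<bullet> b) * (\<integral>\<omega>. (Z \<omega> \<bullet> b) * H (Z \<omega>) \<partial>M))"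
    using i1 by (simp add: Bochner_Integration.integral_sum)
  also have "\<dots> = (\<Sum>b\<in>Basis. (c \<bullet> b) * (\<integral>\<omega>. H' (Z \<omega>) b \<partial>M))"
  proof (intro sum.cong refl arg_cong2[where f="(*)"] stein_basis[OF Z _ deriv cont bnd(1)])
    show "\<bar>H' z b\<bar> \<le> B'" if "b \<in> Basis" for z b
      using bnd(2)[of z b] that by simp
  qed
  also have "\<dots> = (\<integral>\<omega>. (\<Sum>b\<in>Basis. (c \<bullet> b) * H' (Z \<omega>) b) \<partial>M)"
    using i2 by (simp add: Bochner_Integration.integral_sum)
  also have "\<dots> = (\<integral>\<omega>. H' (Z \<omega>) c \<partial>M)"
  proof (rule arg_cong[where f="integral\<^sup>L M"], rule ext)
    fix \<omega>
    have "H' (Z \<omega>) c = H' (Z \<omega>) (\<Sum>b\<in>Basis. (c \<bullet> b) *\<^sub>R b)" by (simp add: euclidean_representation)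
    also have "\<dots> = (\<Sum>b\<in>Basis. (c \<bullet> b) * H' (Z \<omega>) b)"
      using has_derivative_linear[OF deriv, of "Z \<omega>"] by (simp add: linear_sum linear_scale o_def)
    finally show "(\<Sum>b\<in>Basis. (c \<bullet> b) * H' (Z \<omega>) b) = H' (Z \<omega>) c" ..
  qed
  finally show "(\<integral>\<omega>. (Z \<omega> \<bullet> c) * H (Z \<omega>) \<partial>M) = (\<integral>\<omega>. H' (Z \<omega>) c \<partial>M)" .
qed

section \<open>Joining independent Gaussian vectors\<close>

text \<open>For a finite family, independence need only be tested on full boxes: a box may have the whole line as a factor.
  In this form independence is easy to transport along bijections and to combine over blocks of coordinates.\<close>

lemma iid_std_normal_iff_box:
  assumes "prob_space M" and I: "I \<noteq> {}" "finite I"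
  shows "iid_std_normal M X I \<longleftrightarrow>
    (\<forall>i\<in>I. distributed M lborel (X i) std_normal_density) \<and>
    (\<forall>A\<in>I \<rightarrow> sets borel. measure M (\<Inter>i\<in>I. X i -` A i \<inter> space M)
        = (\<Prod>i\<in>I. measure std_normal_distribution (A i)))"
proof (cases "\<forall>i\<in>I. distributed M lborel (X i) std_normal_density")
  case True
  interpret prob_space M by fact
  have rv: "X i \<in> borel_measurable M" if "i \<in> I" for i
    using True that distributed_measurable[of M lborel "X i"] by auto
  have "indep_vars (\<lambda>_. borel) X I \<longleftrightarrow> (\<forall>A\<in>I \<rightarrow> sets borel.
      prob (\<Inter>j\<in>I. X j -` A j \<inter> space M) = (\<Prod>j\<in>I. prob (X j -` A j \<inter> space M)))"
  proof (rule indep_vars_finite[OF I])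
    show "sets borel = sigma_sets (space borel) (sets borel)"
      by (rule sets.sigma_sets_eq[symmetric])
  qed (use rv in \<open>auto intro: Int_stableI\<close>)
  moreover have "prob (X i -` A \<inter> space M) = measure std_normal_distribution A"
    if "i \<in> I" "A \<in> sets borel" for i A
  proof -
    have "std_normal_distribution = distr M lborel (X i)"
      using True that distributed_distr_eq_density[of M lborel "X i" "\<lambda>x. ennreal (std_normal_density x)"]
      by simp
    then show ?thesis using rv that by (simp add: measure_distr)
  qed
  ultimately show ?thesis
    unfolding iid_std_normal_def using True
    by (auto intro!: ball_cong prod.cong simp: Pi_iff) 
next
  case False
  then show ?thesis by (auto simp: iid_std_normal_def)
qed

lemma iid_std_normal_reindex:
  assumes M: "prob_space M" and "finite K" "K \<noteq> {}" and inj: "inj_on \<phi> K"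
    and iid: "iid_std_normal M (\<lambda>k. X (\<phi> k)) K"
  shows "iid_std_normal M X (\<phi> ` K)"
proof -
  have "measure M (\<Inter>i\<in>\<phi> ` K. X i -` A i \<inter> space M) = (\<Prod>i\<in>\<phi> ` K. measure std_normal_distribution (A i))"
    if "A \<in> \<phi> ` K \<rightarrow> sets borel" for A
  proof -
    have "(\<lambda>k. A (\<phi> k)) \<in> K \<rightarrow> sets borel" using that by auto
    then have "measure M (\<Inter>k\<in>K. X (\<phi> k) -` A (\<phi> k) \<inter> space M) = (\<Prod>k\<in>K. measure std_normal_distribution (A (\<phi> k)))"
      by (rule bspec[OF conjunct2[OF iid_std_normal_iff_box[OF M \<open>K \<noteq> {}\<close> \<open>finite K\<close>, THEN iffD1, OF iid]]])
    then show ?thesis using \<open>K \<noteq> {}\<close> by (simp add: prod.reindex[OF inj])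
  qed
  moreover have "\<forall>i\<in>\<phi> ` K. distributed M lborel (X i) std_normal_density"
    using iid by (auto simp: iid_std_normal_def)
  ultimately show ?thesis
    using assms by (subst iid_std_normal_iff_box) auto
qed

lemma std_gaussian_vec:
  fixes u :: "'w \<Rightarrow> real ^ 'm"
  assumes M: "prob_space M" and iid: "iid_std_normal M (\<lambda>i \<omega>. u \<omega> $ i) UNIV"
  shows "std_gaussian M u"
proof -
  have "iid_std_normal M (\<lambda>b \<omega>. u \<omega> \<bullet> b) (range (\<lambda>i. axis i 1))"
    using iid by (intro iid_std_normal_reindex[OF M]) (auto simp: inner_axis inj_on_def axis_eq_axis)
  moreover have "range (\<lambda>i. axis i 1) = (Basis :: (real ^ 'm) set)"
    by (auto simp: Basis_vec_def)
  ultimately show ?thesis using M by (simp add: std_gaussian_def)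
qed

lemma std_gaussian_matrix:
  fixes G :: "'w \<Rightarrow> real ^ 'n ^ 'm"
  assumes M: "prob_space M" and iid: "iid_std_normal M (\<lambda>(i, j) \<omega>. G \<omega> $ i $ j) UNIV"
  shows "std_gaussian M G"
proof -
  have "iid_std_normal M (\<lambda>b \<omega>. G \<omega> \<bullet> b) (range (\<lambda>(i, j). axis i (axis j 1)))"
    using iid by (intro iid_std_normal_reindex[OF M])
      (auto simp: inner_axis inj_on_def axis_eq_axis case_prod_unfold)
  moreover have "range (\<lambda>(i, j). axis i (axis j 1)) = (Basis :: (real ^ 'n ^ 'm) set)"
    by (auto simp: Basis_vec_def image_iff) 
  ultimately show ?thesis using M by (simp add: std_gaussian_def)
qed

lemma prod_Basis_prod:
  fixes f :: "'a::euclidean_space \<times> 'b::euclidean_space \<Rightarrow> real"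
  shows "(\<Prod>b\<in>Basis. f b) = (\<Prod>a\<in>Basis. f (a, 0)) * (\<Prod>b\<in>Basis. f (0, b))"
  unfolding Basis_prod_def
  by (subst prod.union_disjoint) (auto simp: prod.reindex inj_on_def)

text \<open>A box in the product space is the intersection of one box for each component. The three boxes are
  independent events, and the probability of each is a product over its own coordinates.\<close>

lemma std_gaussian_triple:
  fixes X :: "'w \<Rightarrow> 'a::euclidean_space" and Y :: "'w \<Rightarrow> 'b::euclidean_space"
    and Z :: "'w \<Rightarrow> 'c::euclidean_space"
  assumes X: "std_gaussian M X" and Y: "std_gaussian M Y" and Z: "std_gaussian M Z"
    and indep: "indep_three M X Y Z"
  shows "std_gaussian M (\<lambda>\<omega>. (X \<omega>, Y \<omega>, Z \<omega>))"
proof -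
  interpret prob_space M using X by (simp add: std_gaussian_def)
  let ?N = "measure std_normal_distribution"
  let ?W = "\<lambda>b \<omega>. (X \<omega>, Y \<omega>, Z \<omega>) \<bullet> b"
  have box: "prob (\<Inter>b\<in>Basis. (\<lambda>\<omega>. V \<omega> \<bullet> b) -` A b \<inter> space M) = (\<Prod>b\<in>Basis. ?N (A b))"
    if "std_gaussian M V" "A \<in> Basis \<rightarrow> sets borel" for V :: "'w \<Rightarrow> 'd::euclidean_space" and A
    using that iid_std_normal_iff_box[of M Basis "\<lambda>b \<omega>. V \<omega> \<bullet> b"] by (auto simp: std_gaussian_def)
  have gen: "(\<Inter>b\<in>Basis. (\<lambda>\<omega>. V \<omega> \<bullet> b) -` A b \<inter> space M) \<in> generated_events M V"
    if A: "A \<in> Basis \<rightarrow> sets borel" for V :: "'w \<Rightarrow> 'd::euclidean_space" and A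
  proof -
    have "{z. \<forall>b\<in>Basis. z \<bullet> b \<in> A b} = (\<Inter>b\<in>Basis. (\<lambda>z. z \<bullet> b) -` A b \<inter> space borel)" by auto
    also have "\<dots> \<in> sets borel"
      using A by (intro sets.finite_INT measurable_sets[where A=borel]) auto
    finally have "{z. \<forall>b\<in>Basis. z \<bullet> b \<in> A b} \<in> sets borel" .
    moreover have "(\<Inter>b\<in>Basis. (\<lambda>\<omega>. V \<omega> \<bullet> b) -` A b \<inter> space M) = V -` {z. \<forall>b\<in>Basis. z \<bullet> b \<in> A b} \<inter> space M"
      by auto
    ultimately show ?thesis unfolding generated_events_def by blast
  qed
  have "prob (\<Inter>b\<in>Basis. ?W b -` A b \<inter> space M) = (\<Prod>b\<in>Basis. ?N (A b))"
    if A: "A \<in> Basis \<rightarrow> sets borel" for A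
  proof -
    define E1 where "E1 = (\<Inter>b\<in>Basis. (\<lambda>\<omega>. X \<omega> \<bullet> b) -` A (b, 0, 0) \<inter> space M)"
    define E2 where "E2 = (\<Inter>b\<in>Basis. (\<lambda>\<omega>. Y \<omega> \<bullet> b) -` A (0, b, 0) \<inter> space M)"
    define E3 where "E3 = (\<Inter>b\<in>Basis. (\<lambda>\<omega>. Z \<omega> \<bullet> b) -` A (0, 0, b) \<inter> space M)"
    have "b \<in> Basis \<Longrightarrow> (b, 0, 0) \<in> Basis" "b' \<in> Basis \<Longrightarrow> (0, b', 0) \<in> Basis"
      "b'' \<in> Basis \<Longrightarrow> (0, 0, b'') \<in> Basis" for b :: 'a and b' :: 'b and b'' :: 'c
      by (auto simp: Basis_prod_def zero_prod_def)
    then have A': "(\<lambda>b. A (b, 0, 0)) \<in> Basis \<rightarrow> sets borel" "(\<lambda>b. A (0, b, 0)) \<in> Basis \<rightarrow> sets borel"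
      "(\<lambda>b. A (0, 0, b)) \<in> Basis \<rightarrow> sets borel"
      using A by (auto simp: Pi_iff)
    have ball: "(\<forall>b\<in>Basis. P b) \<longleftrightarrow>
        (\<forall>b\<in>Basis. P (b, 0, 0)) \<and> (\<forall>b\<in>Basis. P (0, b, 0)) \<and> (\<forall>b\<in>Basis. P (0, 0, b))"
      for P :: "'a \<times> 'b \<times> 'c \<Rightarrow> bool"
      by (simp add: Basis_prod_def ball_Un zero_prod_def)
    have "(\<Inter>b\<in>Basis. ?W b -` A b \<inter> space M) = {\<omega>\<in>space M. \<forall>b\<in>Basis. ?W b \<omega> \<in> A b}"
      by auto
    also have "\<dots> = E1 \<inter> E2 \<inter> E3"
      unfolding ball E1_def E2_def E3_def by auto
    also have "\<dots> = (\<Inter>k\<in>{..<3}. [E1, E2, E3] ! k)"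
      by (auto simp: numeral_3_eq_3 lessThan_Suc)
    also have "prob \<dots> = (\<Prod>k\<in>{..<3}. prob ([E1, E2, E3] ! k))"
    proof (rule indep_setsD)
      show "indep_sets (\<lambda>k. [generated_events M X, generated_events M Y, generated_events M Z] ! k) {..<3}"
        using indep by (simp add: indep_three_def)
      show "\<forall>j\<in>{..<3}. [E1, E2, E3] ! j \<in> [generated_events M X, generated_events M Y, generated_events M Z] ! j"
        using gen[OF A'(1)] gen[OF A'(2)] gen[OF A'(3)]
        by (auto simp: numeral_3_eq_3 lessThan_Suc E1_def E2_def E3_def)
    qed (auto simp: numeral_3_eq_3 lessThan_Suc)
    also have "\<dots> = prob E1 * prob E2 * prob E3" by (simp add: numeral_3_eq_3 lessThan_Suc)
    also have "\<dots> = (\<Prod>b\<in>Basis. ?N (A b))"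
      unfolding prod_Basis_prod E1_def E2_def E3_def box[OF X A'(1)] box[OF Y A'(2)] box[OF Z A'(3)]
      by (simp add: zero_prod_def)
    finally show ?thesis .
  qed
  moreover have "\<forall>b\<in>Basis. distributed M lborel (?W b) std_normal_density"
    using X Y Z by (auto simp: Basis_prod_def std_gaussian_def iid_std_normal_def)
  ultimately show ?thesis
    unfolding std_gaussian_def by (simp add: iid_std_normal_iff_box prob_space_axioms)
qed

section \<open>Log-sum-exp, softmax and the smoothed norm\<close>

definition softmax :: "real \<Rightarrow> 'i set \<Rightarrow> ('i \<Rightarrow> real) \<Rightarrow> 'i \<Rightarrow> real" where
  "softmax \<beta> I w i = exp (\<beta> * w i) / (\<Sum>j\<in>I. exp (\<beta> * w j))"

definition log_sum_exp :: "real \<Rightarrow> 'i set \<Rightarrow> ('i \<Rightarrow> real) \<Rightarrow> real" where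
  "log_sum_exp \<beta> I w = ln (\<Sum>j\<in>I. exp (\<beta> * w j)) / \<beta>"

lemma sum_exp_pos:
  fixes w :: "'i \<Rightarrow> real"
  assumes "finite I" "I \<noteq> {}"
  shows "0 < (\<Sum>j\<in>I. exp (\<beta> * w j))"
  using assms by (intro sum_pos) auto

lemma softmax_nonneg: "0 \<le> softmax \<beta> I w i"
  unfolding softmax_def by (intro divide_nonneg_nonneg sum_nonneg) auto

lemma sum_softmax:
  assumes "finite I" "I \<noteq> {}"
  shows "(\<Sum>i\<in>I. softmax \<beta> I w i) = 1"
  using sum_exp_pos[OF assms, of \<beta> w] by (simp add: softmax_def flip: sum_divide_distrib)

lemma softmax_le_1:
  assumes "finite I" "i \<in> I"
  shows "softmax \<beta> I w i \<le> 1"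
  using sum_softmax[of I \<beta> w] assms member_le_sum[of i I "softmax \<beta> I w"] softmax_nonneg by fastforce

lemma log_sum_exp_has_derivative:
  assumes I: "finite I" "I \<noteq> {}" and "\<beta> \<noteq> 0"
    and w: "\<And>i. i \<in> I \<Longrightarrow> (w i has_derivative w' i) (at z)"
  shows "((\<lambda>z. log_sum_exp \<beta> I (\<lambda>i. w i z)) has_derivative
     (\<lambda>h. \<Sum>i\<in>I. softmax \<beta> I (\<lambda>i. w i z) i * w' i h)) (at z)"
proof -
  let ?S = "\<Sum>j\<in>I. exp (\<beta> * w j z)"
  have S: "?S > 0" by (rule sum_exp_pos[OF I])
  have "((\<lambda>z. log_sum_exp \<beta> I (\<lambda>i. w i z)) has_derivative
      (\<lambda>h. (\<Sum>i\<in>I. exp (\<beta> * w i z) * (\<beta> * w' i h)) * inverse ?S / \<beta>)) (at z)"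
    unfolding log_sum_exp_def
    using S \<open>\<beta> \<noteq> 0\<close> by (auto intro!: derivative_eq_intros w simp: sum_distrib_left ac_simps divide_simps)
  moreover have "(\<Sum>i\<in>I. exp (\<beta> * w i z) * (\<beta> * w' i h)) * inverse ?S / \<beta>
      = (\<Sum>i\<in>I. softmax \<beta> I (\<lambda>i. w i z) i * w' i h)" for h
    using \<open>\<beta> \<noteq> 0\<close> S by (simp add: softmax_def sum_distrib_right sum_divide_distrib field_simps)
  ultimately show ?thesis by simp
qed

lemma softmax_has_derivative:
  assumes I: "finite I" "i \<in> I"
    and w: "\<And>i. i \<in> I \<Longrightarrow> (w i has_derivative w' i) (at z)"
  shows "((\<lambda>z. softmax \<beta> I (\<lambda>i. w i z) i) has_derivative
     (\<lambda>h. \<beta> * softmax \<beta> I (\<lambda>i. w i z) i * (w' i h - (\<Sum>j\<in>I. softmax \<beta> I (\<lambda>i. w i z) j * w' j h)))) (at z)"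
proof -
  define S where "S = (\<Sum>j\<in>I. exp (\<beta> * w j z))"
  have S: "S > 0" unfolding S_def using I by (intro sum_exp_pos) auto
  have "((\<lambda>z. softmax \<beta> I (\<lambda>i. w i z) i) has_derivative
      (\<lambda>h. (exp (\<beta> * w i z) * (\<beta> * w' i h) * S
          - exp (\<beta> * w i z) * (\<Sum>j\<in>I. exp (\<beta> * w j z) * (\<beta> * w' j h))) / (S * S))) (at z)"
    unfolding softmax_def S_def
    using S I by (auto intro!: derivative_eq_intros w simp: ac_simps S_def)
  moreover have "(exp (\<beta> * w i z) * (\<beta> * w' i h) * S
          - exp (\<beta> * w i z) * (\<Sum>j\<in>I. exp (\<beta> * w j z) * (\<beta> * w' j h))) / (S * S)
      = \<beta> * softmax \<beta> I (\<lambda>i. w i z) i * (w' i h - (\<Sum>j\<in>I. softmax \<beta> I (\<lambda>i. w i z) j * w' j h))" for h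
  proof -
    have "(\<Sum>j\<in>I. exp (\<beta> * w j z) * (\<beta> * w' j h)) = \<beta> * S * (\<Sum>j\<in>I. softmax \<beta> I (\<lambda>i. w i z) j * w' j h)"
      unfolding softmax_def sum_distrib_left S_def[symmetric] using S by (intro sum.cong) (auto simp: field_simps)
    then show ?thesis
      using S by (simp add: softmax_def field_simps flip: S_def)
  qed
  ultimately show ?thesis by simp
qed

text \<open>Log-sum-exp is increasing in every argument and commutes with adding a constant to all of them.\<close>

lemma log_sum_exp_le:
  assumes I: "finite I" "I \<noteq> {}" and "\<beta> > 0" and le: "\<And>i. i \<in> I \<Longrightarrow> w i \<le> v i + d"
  shows "log_sum_exp \<beta> I w \<le> log_sum_exp \<beta> I v + d"
proof -
  have "(\<Sum>j\<in>I. exp (\<beta> * w j)) \<le> (\<Sum>j\<in>I. exp (\<beta> * v j) * exp (\<beta> * d))"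
    using le \<open>\<beta> > 0\<close> by (intro sum_mono) (simp flip: exp_add distrib_left)
  also have "\<dots> = exp (\<beta> * d) * (\<Sum>j\<in>I. exp (\<beta> * v j))"
    by (simp add: sum_distrib_left mult.commute)
  finally have "ln (\<Sum>j\<in>I. exp (\<beta> * w j)) \<le> \<beta> * d + ln (\<Sum>j\<in>I. exp (\<beta> * v j))"
    using sum_exp_pos[OF I, of \<beta> w] sum_exp_pos[OF I, of \<beta> v]
    by (metis exp_gt_zero ln_exp ln_le_cancel_iff ln_mult_pos mult_pos_pos)
  then show ?thesis using \<open>\<beta> > 0\<close> by (simp add: log_sum_exp_def field_simps)
qed

lemma log_sum_exp_nonexpansive:
  assumes "finite I" "I \<noteq> {}" "\<beta> > 0" "\<And>i. i \<in> I \<Longrightarrow> \<bar>w i - v i\<bar> \<le> d"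
  shows "\<bar>log_sum_exp \<beta> I w - log_sum_exp \<beta> I v\<bar> \<le> d"
proof -
  have "w i \<le> v i + d" "v i \<le> w i + d" if "i \<in> I" for i
    using assms(4)[OF that] by linarith+
  then show ?thesis
    using log_sum_exp_le[OF assms(1-3), of w v d] log_sum_exp_le[OF assms(1-3), of v w d] by fastforce
qed

text \<open>A smooth substitute for the norm, within \<open>\<epsilon>\<close> of it, whose gradient stays in the unit ball.\<close>

definition smooth_norm :: "real \<Rightarrow> 'a::real_inner \<Rightarrow> real" where
  "smooth_norm \<epsilon> a = sqrt (\<epsilon>\<^sup>2 + a \<bullet> a)"

lemma norm_le_smooth_norm: "norm a \<le> smooth_norm \<epsilon> a"
  by (simp add: smooth_norm_def norm_eq_sqrt_inner)

lemma smooth_norm_le: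
  assumes "\<epsilon> \<ge> 0"
  shows "smooth_norm \<epsilon> a \<le> norm a + \<epsilon>"
  using assms unfolding smooth_norm_def dot_square_norm
  by (intro real_le_lsqrt) (auto simp: power2_sum)

lemma smooth_norm_ge: 
  assumes "\<epsilon> \<ge> 0"
  shows "\<epsilon> \<le> smooth_norm \<epsilon> a"
  unfolding smooth_norm_def by (rule real_le_rsqrt) simp

lemma smooth_norm_has_derivative:
  assumes "\<epsilon> > 0"
  shows "(smooth_norm \<epsilon> has_derivative (\<lambda>h. (a \<bullet> h) / smooth_norm \<epsilon> a)) (at a)"
proof -
  have "\<epsilon>\<^sup>2 + a \<bullet> a > 0" using assms by (simp add: add_pos_nonneg)
  then show ?thesis
    unfolding smooth_norm_def
    by (auto intro!: derivative_eq_intros simp: inner_commute field_simps)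
qed

lemma smooth_norm_gradient_has_derivative:
  assumes "\<epsilon> > 0"
  shows "((\<lambda>a. (a \<bullet> e) / smooth_norm \<epsilon> a) has_derivative
    (\<lambda>h. (h \<bullet> e) / smooth_norm \<epsilon> a - (a \<bullet> e) * (a \<bullet> h) / smooth_norm \<epsilon> a ^ 3)) (at a)"
proof -
  have "smooth_norm \<epsilon> a > 0" using smooth_norm_ge[of \<epsilon> a] assms by simp
  then show ?thesis
    by (auto intro!: derivative_eq_intros smooth_norm_has_derivative assms
      simp: field_simps power3_eq_cube)
qed

section \<open>Gibbs weights driven by linear images of a Gaussian vector\<close>

text \<open>Log-sum-exp is 1-Lipschitz for the maximum norm and so inherits the linear growth of its arguments.\<close>

lemma integrable_log_sum_exp:
  fixes Z :: "'w \<Rightarrow> 'a::euclidean_space"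
  assumes Z: "std_gaussian M Z" and I: "finite I" "I \<noteq> {}" and \<beta>: "\<beta> > 0"
    and cont: "\<And>i. i \<in> I \<Longrightarrow> continuous_on UNIV (w i)"
    and bnd: "\<And>i z. i \<in> I \<Longrightarrow> \<bar>w i z\<bar> \<le> C + K * norm z"
  shows "integrable M (\<lambda>\<omega>. log_sum_exp \<beta> I (\<lambda>i. w i (Z \<omega>)))"
proof (rule std_gaussian_integrable_linear_growth[OF Z, of _ "\<bar>log_sum_exp \<beta> I (\<lambda>_. 0)\<bar> + C" K])
  show "(\<lambda>z. log_sum_exp \<beta> I (\<lambda>i. w i z)) \<in> borel_measurable borel"
    unfolding log_sum_exp_def using sum_exp_pos[OF I] \<beta>
    by (intro borel_measurable_continuous_onI continuous_intros cont) (auto simp: less_imp_neq[THEN not_sym])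
  show "\<bar>log_sum_exp \<beta> I (\<lambda>i. w i z)\<bar> \<le> \<bar>log_sum_exp \<beta> I (\<lambda>_. 0)\<bar> + C + K * norm z" for z
    using log_sum_exp_nonexpansive[OF I \<beta>, of "\<lambda>i. w i z" "\<lambda>_. 0" "C + K * norm z"] bnd by fastforce
qed

text \<open>The state of the interpolation at one fixed time: every energy is a smoothed norm of a linear image of the
  Gaussian vector plus a linear form. In the interpolation these linear maps change with time,
  whereas integration by parts takes place at a fixed time.\<close>

locale softmax_model =
  fixes I :: "'i set" and \<beta> s \<epsilon> :: real
    and a :: "'i \<Rightarrow> 'z::euclidean_space \<Rightarrow> 'v::euclidean_space" and b :: "'i \<Rightarrow> 'z \<Rightarrow> real"
  assumes I: "finite I" "I \<noteq> {}" and \<beta>: "\<beta> > 0" and \<epsilon>: "\<epsilon> > 0"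
    and a: "\<And>i. bounded_linear (a i)" and b: "\<And>i. bounded_linear (b i)"
begin

definition energy :: "'i \<Rightarrow> 'z \<Rightarrow> real" where
  "energy i z = s * smooth_norm \<epsilon> (a i z) + b i z"

definition weight :: "'i \<Rightarrow> 'z \<Rightarrow> real" where
  "weight i z = softmax \<beta> I (\<lambda>i. energy i z) i"

text \<open>The gradient of the smoothed norm at \<open>a i z\<close>.\<close>

definition grad :: "'i \<Rightarrow> 'z \<Rightarrow> 'v" where
  "grad i z = a i z /\<^sub>R smooth_norm \<epsilon> (a i z)"

definition energy_deriv :: "'i \<Rightarrow> 'z \<Rightarrow> 'z \<Rightarrow> real" where
  "energy_deriv i z h = s * (grad i z \<bullet> a i h) + b i h"

definition weight_deriv :: "'i \<Rightarrow> 'z \<Rightarrow> 'z \<Rightarrow> real" where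
  "weight_deriv i z h = \<beta> * weight i z * (energy_deriv i z h - (\<Sum>j\<in>I. weight j z * energy_deriv j z h))"

lemma smooth_norm_pos: "smooth_norm \<epsilon> v > 0"
  using smooth_norm_ge[of \<epsilon> v] \<epsilon> by simp

lemma smooth_norm_nonzero: "smooth_norm \<epsilon> v \<noteq> 0"
  using smooth_norm_pos[of v] by simp

lemma weight_bounds: "0 \<le> weight i z" "i \<in> I \<Longrightarrow> weight i z \<le> 1"
  using I by (auto simp: weight_def softmax_nonneg softmax_le_1)

lemma sum_weight: "(\<Sum>i\<in>I. weight i z) = 1"
  using I by (simp add: weight_def sum_softmax)

lemma norm_grad_le_1: "norm (grad i z) \<le> 1"
  using norm_le_smooth_norm[of "a i z" \<epsilon>] smooth_norm_pos[of "a i z"]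
  by (simp add: grad_def divide_simps)

lemma energy_has_derivative: "(energy i has_derivative energy_deriv i z) (at z)"
proof -
  have "((\<lambda>z. smooth_norm \<epsilon> (a i z)) has_derivative (\<lambda>h. (a i z \<bullet> a i h) / smooth_norm \<epsilon> (a i z))) (at z)"
    by (rule has_derivative_compose[OF bounded_linear_imp_has_derivative[OF a] smooth_norm_has_derivative[OF \<epsilon>]])
  then show ?thesis
    unfolding energy_def energy_deriv_def grad_def
    by (auto intro!: derivative_eq_intros bounded_linear_imp_has_derivative[OF b] simp: divide_inverse_commute)
qed

lemma weight_has_derivative:
  "i \<in> I \<Longrightarrow> (weight i has_derivative weight_deriv i z) (at z)"
  unfolding weight_def weight_deriv_def
  by (rule softmax_has_derivative[OF I(1)]) (auto intro: energy_has_derivative)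

lemma grad_inner_has_derivative:
  "((\<lambda>z. grad i z \<bullet> e) has_derivative
     (\<lambda>h. (a i h \<bullet> e - (grad i z \<bullet> e) * (grad i z \<bullet> a i h)) / smooth_norm \<epsilon> (a i z))) (at z)"
proof -
  let ?N = "smooth_norm \<epsilon> (a i z)"
  have "((\<lambda>z. (a i z \<bullet> e) / smooth_norm \<epsilon> (a i z)) has_derivative
     (\<lambda>h. (a i h \<bullet> e) / ?N - (a i z \<bullet> e) * (a i z \<bullet> a i h) / ?N ^ 3)) (at z)"
    by (rule has_derivative_compose[OF bounded_linear_imp_has_derivative[OF a] smooth_norm_gradient_has_derivative[OF \<epsilon>]])
  moreover have "(a i h \<bullet> e) / ?N - (a i z \<bullet> e) * (a i z \<bullet> a i h) / ?N ^ 3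
    = (a i h \<bullet> e - (grad i z \<bullet> e) * (grad i z \<bullet> a i h)) / ?N" for h
    by (simp add: grad_def divide_inverse power3_eq_cube algebra_simps)
  moreover have "(\<lambda>z. (a i z \<bullet> e) / smooth_norm \<epsilon> (a i z)) = (\<lambda>z. grad i z \<bullet> e)"
    by (simp add: grad_def divide_inverse mult.commute)
  ultimately show ?thesis by (simp only:)
qed

lemma cont_a: "continuous_on UNIV (a i)"
  by (rule bounded_linear.continuous_on[OF a continuous_on_id])

lemma cont_energy: "continuous_on UNIV (energy i)"
  by (intro continuous_at_imp_continuous_on ballI has_derivative_continuous[OF energy_has_derivative])

lemma cont_smooth_norm: "continuous_on UNIV (\<lambda>z. smooth_norm \<epsilon> (a i z))"
  unfolding smooth_norm_def by (intro continuous_intros cont_a)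

lemma cont_grad: "continuous_on UNIV (grad i)"
  unfolding grad_def
  by (intro continuous_intros cont_a cont_smooth_norm) (simp add: smooth_norm_nonzero)

lemma cont_weight: "i \<in> I \<Longrightarrow> continuous_on UNIV (weight i)"
  by (intro continuous_at_imp_continuous_on ballI has_derivative_continuous[OF weight_has_derivative])

lemma cont_weight_deriv: "i \<in> I \<Longrightarrow> continuous_on UNIV (\<lambda>z. weight_deriv i z h)"
  unfolding weight_deriv_def energy_deriv_def by (intro continuous_intros cont_weight cont_grad)

text \<open>A Lipschitz constant common to all energies; it makes the bounds required for integration by parts
  uniform in the Gaussian variable.\<close>

definition lip :: real where
  "lip = (\<Sum>i\<in>I. \<bar>s\<bar> * onorm (a i) + onorm (b i))"

lemma le_lip: "i \<in> I \<Longrightarrow> \<bar>s\<bar> * onorm (a i) + onorm (b i) \<le> lip"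
  unfolding lip_def using I(1)
  by (intro member_le_sum) (auto intro!: add_nonneg_nonneg mult_nonneg_nonneg onorm_pos_le a b)

lemma abs_grad_inner_le: "\<bar>grad i z \<bullet> v\<bar> \<le> norm v"
  using Cauchy_Schwarz_ineq2[of "grad i z" v] mult_right_mono[OF norm_grad_le_1[of i z] norm_ge_zero[of v]]
  by linarith

lemma abs_energy_deriv_le:
  assumes "i \<in> I"
  shows "\<bar>energy_deriv i z h\<bar> \<le> lip * norm h"
proof -
  have "\<bar>energy_deriv i z h\<bar> \<le> \<bar>s\<bar> * \<bar>grad i z \<bullet> a i h\<bar> + \<bar>b i h\<bar>"
    unfolding energy_deriv_def by (rule order_trans[OF abs_triangle_ineq]) (simp add: abs_mult)
  also have "\<dots> \<le> \<bar>s\<bar> * (onorm (a i) * norm h) + onorm (b i) * norm h"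
    using onorm[OF b, of i h]
    by (intro add_mono mult_left_mono order_trans[OF abs_grad_inner_le] onorm[OF a]) auto
  also have "\<dots> = (\<bar>s\<bar> * onorm (a i) + onorm (b i)) * norm h"
    by (simp add: algebra_simps)
  also have "\<dots> \<le> lip * norm h"
    by (intro mult_right_mono le_lip assms) auto
  finally show ?thesis .
qed

lemma abs_energy_le:
  assumes "i \<in> I"
  shows "\<bar>energy i z\<bar> \<le> \<bar>s\<bar> * \<epsilon> + lip * norm z"
proof -
  have "\<bar>energy i z\<bar> \<le> \<bar>s\<bar> * \<bar>smooth_norm \<epsilon> (a i z)\<bar> + \<bar>b i z\<bar>"
    unfolding energy_def by (rule order_trans[OF abs_triangle_ineq]) (simp add: abs_mult)
  also have "\<dots> \<le> \<bar>s\<bar> * (onorm (a i) * norm z + \<epsilon>) + onorm (b i) * norm z"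
    using onorm[OF b, of i z] onorm[OF a, of i z] smooth_norm_le[of \<epsilon> "a i z"] smooth_norm_pos[of "a i z"] \<epsilon>
    by (intro add_mono mult_left_mono) auto
  also have "\<dots> = \<bar>s\<bar> * \<epsilon> + (\<bar>s\<bar> * onorm (a i) + onorm (b i)) * norm z"
    by (simp add: algebra_simps)
  also have "\<dots> \<le> \<bar>s\<bar> * \<epsilon> + lip * norm z"
    by (intro add_left_mono mult_right_mono le_lip assms) auto
  finally show ?thesis .
qed

lemma abs_mean_energy_deriv_le: "\<bar>\<Sum>j\<in>I. weight j z * energy_deriv j z h\<bar> \<le> lip * norm h"
proof -
  have "\<bar>\<Sum>j\<in>I. weight j z * energy_deriv j z h\<bar> \<le> (\<Sum>j\<in>I. weight j z * (lip * norm h))"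
    using abs_energy_deriv_le weight_bounds
    by (intro order_trans[OF sum_abs] sum_mono) (auto simp: abs_mult intro!: mult_left_mono)
  then show ?thesis by (simp add: sum_weight flip: sum_distrib_right)
qed

lemma abs_weight_deriv_le:
  assumes "i \<in> I"
  shows "\<bar>weight_deriv i z h\<bar> \<le> 2 * \<beta> * lip * norm h"
proof -
  have "\<bar>weight_deriv i z h\<bar> = weight i z * (\<beta> * \<bar>energy_deriv i z h - (\<Sum>j\<in>I. weight j z * energy_deriv j z h)\<bar>)"
    using \<beta> weight_bounds(1)[of i z] by (simp add: weight_deriv_def abs_mult)
  also have "\<dots> \<le> 1 * (\<beta> * \<bar>energy_deriv i z h - (\<Sum>j\<in>I. weight j z * energy_deriv j z h)\<bar>)"
    using weight_bounds(2)[OF assms] \<beta> by (intro mult_right_mono) auto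
  also have "\<dots> \<le> \<beta> * (2 * (lip * norm h))"
    using abs_energy_deriv_le[OF assms, of z h] abs_mean_energy_deriv_le[of z h] \<beta> by auto
  finally show ?thesis by (simp add: ac_simps)
qed

lemma stein_weight:
  assumes Z: "std_gaussian M Z" and i: "i \<in> I"
  shows "integrable M (\<lambda>\<omega>. (Z \<omega> \<bullet> c) * weight i (Z \<omega>))"
    and "integrable M (\<lambda>\<omega>. weight_deriv i (Z \<omega>) c)"
    and "(\<integral>\<omega>. (Z \<omega> \<bullet> c) * weight i (Z \<omega>) \<partial>M) = (\<integral>\<omega>. weight_deriv i (Z \<omega>) c \<partial>M)"
proof -
  have "\<bar>weight i z\<bar> \<le> 1" for z using weight_bounds i by simp
  note * = Z weight_has_derivative[OF i] cont_weight_deriv[OF i] this abs_weight_deriv_le[OF i]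
  show "integrable M (\<lambda>\<omega>. (Z \<omega> \<bullet> c) * weight i (Z \<omega>))"
    "integrable M (\<lambda>\<omega>. weight_deriv i (Z \<omega>) c)"
    "(\<integral>\<omega>. (Z \<omega> \<bullet> c) * weight i (Z \<omega>) \<partial>M) = (\<integral>\<omega>. weight_deriv i (Z \<omega>) c \<partial>M)"
    by (rule stein[OF *])+
qed

text \<open>Along a direction in the kernel of \<open>a i\<close> the factor \<open>grad i\<close> is constant, so the product rule
  leaves only the derivative of the weight. The derivative of \<open>grad i\<close> is needed all the same to
  verify that the product is differentiable with bounded derivative.\<close>

lemma stein_weight_grad:
  assumes Z: "std_gaussian M Z" and i: "i \<in> I" and c: "a i c = 0"
  shows "integrable M (\<lambda>\<omega>. (Z \<omega> \<bullet> c) * (weight i (Z \<omega>) * (grad i (Z \<omega>) \<bullet> e)))"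
    and "integrable M (\<lambda>\<omega>. weight_deriv i (Z \<omega>) c * (grad i (Z \<omega>) \<bullet> e))"
    and "(\<integral>\<omega>. (Z \<omega> \<bullet> c) * (weight i (Z \<omega>) * (grad i (Z \<omega>) \<bullet> e)) \<partial>M)
       = (\<integral>\<omega>. weight_deriv i (Z \<omega>) c * (grad i (Z \<omega>) \<bullet> e) \<partial>M)"
proof -
  define H' where "H' z h = weight i z * ((a i h \<bullet> e - (grad i z \<bullet> e) * (grad i z \<bullet> a i h)) / smooth_norm \<epsilon> (a i z))
      + weight_deriv i z h * (grad i z \<bullet> e)" for z h
  have d: "((\<lambda>z. weight i z * (grad i z \<bullet> e)) has_derivative H' z) (at z)" for z
    unfolding H'_def by (rule has_derivative_mult[OF weight_has_derivative[OF i] grad_inner_has_derivative])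
  have cont: "continuous_on UNIV (\<lambda>z. H' z h)" for h
    unfolding H'_def
    by (intro continuous_intros cont_weight cont_grad cont_weight_deriv cont_smooth_norm i)
      (simp add: smooth_norm_nonzero)
  have bnd: "\<bar>weight i z * (grad i z \<bullet> e)\<bar> \<le> 1 * norm e" for z
    unfolding abs_mult using weight_bounds[of i z] i by (intro mult_mono abs_grad_inner_le) auto
  have bnd': "\<bar>H' z h\<bar> \<le> (2 * (onorm (a i) * norm e) / \<epsilon> + 2 * \<beta> * lip * norm e) * norm h" for z h
  proof -
    let ?D = "a i h \<bullet> e - (grad i z \<bullet> e) * (grad i z \<bullet> a i h)"
    have "\<bar>(grad i z \<bullet> e) * (grad i z \<bullet> a i h)\<bar> \<le> norm e * norm (a i h)"
      unfolding abs_mult by (intro mult_mono abs_grad_inner_le) auto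
    moreover have "\<bar>a i h \<bullet> e\<bar> \<le> norm e * norm (a i h)"
      using Cauchy_Schwarz_ineq2[of "a i h" e] by (simp add: mult.commute)
    ultimately have "\<bar>?D\<bar> \<le> 2 * (norm e * norm (a i h))" by linarith
    also have "\<dots> \<le> 2 * (norm e * (onorm (a i) * norm h))"
      by (intro mult_left_mono onorm[OF a]) auto
    finally have "\<bar>?D\<bar> / smooth_norm \<epsilon> (a i z) \<le> 2 * (norm e * (onorm (a i) * norm h)) / \<epsilon>"
      using smooth_norm_ge[of \<epsilon> "a i z"] \<epsilon> by (intro frac_le) auto
    then have "weight i z * (\<bar>?D\<bar> / smooth_norm \<epsilon> (a i z)) \<le> 1 * (2 * (norm e * (onorm (a i) * norm h)) / \<epsilon>)"
      using weight_bounds[of i z] i smooth_norm_pos[of "a i z"] by (intro mult_mono) auto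
    moreover have "\<bar>weight_deriv i z h * (grad i z \<bullet> e)\<bar> \<le> (2 * \<beta> * lip * norm h) * norm e"
      unfolding abs_mult 
      by (intro mult_mono abs_weight_deriv_le abs_grad_inner_le i order_trans[OF abs_ge_zero abs_weight_deriv_le[OF i, of z]]) auto
    moreover have "\<bar>H' z h\<bar> \<le> weight i z * (\<bar>?D\<bar> / smooth_norm \<epsilon> (a i z)) + \<bar>weight_deriv i z h * (grad i z \<bullet> e)\<bar>"
      unfolding H'_def using weight_bounds(1)[of i z] smooth_norm_pos[of "a i z"]
      by (intro order_trans[OF abs_triangle_ineq]) (simp add: abs_mult)
    ultimately have "\<bar>H' z h\<bar> \<le> 2 * (norm e * (onorm (a i) * norm h)) / \<epsilon> + (2 * \<beta> * lip * norm h) * norm e"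
      by linarith
    then show ?thesis by (simp add: algebra_simps)
  qed
  have H'c: "H' z c = weight_deriv i z c * (grad i z \<bullet> e)" for z
    by (simp add: H'_def c)
  note * = stein[OF Z d cont bnd bnd', of c, unfolded H'c]
  show "integrable M (\<lambda>\<omega>. (Z \<omega> \<bullet> c) * (weight i (Z \<omega>) * (grad i (Z \<omega>) \<bullet> e)))"
    "integrable M (\<lambda>\<omega>. weight_deriv i (Z \<omega>) c * (grad i (Z \<omega>) \<bullet> e))"
    "(\<integral>\<omega>. (Z \<omega> \<bullet> c) * (weight i (Z \<omega>) * (grad i (Z \<omega>) \<bullet> e)) \<partial>M)
       = (\<integral>\<omega>. weight_deriv i (Z \<omega>) c * (grad i (Z \<omega>) \<bullet> e) \<partial>M)"
    by (rule *)+
qed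

end


section \<open>Monotonicity of the interpolation\<close>

text \<open>Differentiation under the integral sign: difference quotients are dominated by g through the mean value
  theorem, and dominated convergence applies along every sequence tending to t.\<close>

lemma has_real_derivative_integral:
  fixes f f' :: "real \<Rightarrow> 'w \<Rightarrow> real"
  assumes int: "\<And>t. integrable M (f t)"
    and deriv: "\<And>t \<omega>. ((\<lambda>t. f t \<omega>) has_real_derivative f' t \<omega>) (at t)"
    and bnd: "\<And>t \<omega>. \<bar>f' t \<omega>\<bar> \<le> g \<omega>" and g: "integrable M g"
  shows "((\<lambda>t. \<integral>\<omega>. f t \<omega> \<partial>M) has_real_derivative (\<integral>\<omega>. f' t \<omega> \<partial>M)) (at t)"
  unfolding has_field_derivative_iff tendsto_at_iff_sequentially
proof (intro allI impI)
  fix X :: "nat \<Rightarrow> real" assume X: "\<forall>i. X i \<in> UNIV - {t}" "X \<longlonglongrightarrow> t"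
  note [measurable] = borel_measurable_integrable[OF int]
  let ?q = "\<lambda>n \<omega>. (f (X n) \<omega> - f t \<omega>) / (X n - t)"
  have lim: "(\<lambda>n. ?q n \<omega>) \<longlonglongrightarrow> f' t \<omega>" for \<omega>
    using deriv[of \<omega> t] X unfolding has_field_derivative_iff tendsto_at_iff_sequentially o_def by blast
  have "(\<lambda>n. \<integral>\<omega>. ?q n \<omega> \<partial>M) \<longlonglongrightarrow> (\<integral>\<omega>. f' t \<omega> \<partial>M)"
  proof (rule integral_dominated_convergence[OF _ _ g])
    show "f' t \<in> borel_measurable M"
      by (rule borel_measurable_LIMSEQ_real[OF lim]) measurable
    show "AE \<omega> in M. norm (?q n \<omega>) \<le> g \<omega>" for n
    proof (rule AE_I2)
      fix \<omega>
      have "norm (f (X n) \<omega> - f t \<omega>) \<le> g \<omega> * norm (X n - t)"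
        by (rule field_differentiable_bound[of UNIV "\<lambda>t. f t \<omega>" "\<lambda>t. f' t \<omega>"])
           (use deriv bnd in auto)
      then show "norm (?q n \<omega>) \<le> g \<omega>" using X(1)[rule_format, of n] by (simp add: divide_simps)
    qed
  qed (use lim in auto)
  moreover have "(\<integral>\<omega>. ?q n \<omega> \<partial>M) = ((\<integral>\<omega>. f (X n) \<omega> \<partial>M) - (\<integral>\<omega>. f t \<omega> \<partial>M)) / (X n - t)" for n
    using int by simp
  ultimately show "((\<lambda>y. ((\<integral>\<omega>. f y \<omega> \<partial>M) - (\<integral>\<omega>. f t \<omega> \<partial>M)) / (y - t)) \<circ> X) \<longlonglongrightarrow> (\<integral>\<omega>. f' t \<omega> \<partial>M)"
    by (simp only: o_def)
qed

text \<open>The two parts of the interpolated process at \<open>t = (sin \<theta>)\<^sup>2\<close>, as linear maps of the Gaussian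
  vector \<open>z = (G, u, h)\<close>.\<close>

definition interp_field :: "('i \<Rightarrow> real ^ 'n) \<Rightarrow> real \<Rightarrow> 'i \<Rightarrow> (real ^ 'n ^ 'm) \<times> (real ^ 'm) \<times> (real ^ 'n) \<Rightarrow> real ^ 'm" where
  "interp_field x \<theta> i z = sin \<theta> *\<^sub>R (fst z *v x i) + cos \<theta> *\<^sub>R fst (snd z)"

definition interp_shift :: "('i \<Rightarrow> real ^ 'n) \<Rightarrow> real \<Rightarrow> 'i \<Rightarrow> (real ^ 'n ^ 'm) \<times> (real ^ 'm) \<times> (real ^ 'n) \<Rightarrow> real" where
  "interp_shift x \<theta> i z = cos \<theta> * (snd (snd z) \<bullet> x i)"

lemma bounded_linear_matrix_apply: "bounded_linear (\<lambda>G :: real ^ 'n ^ 'm. G *v v)"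
  by (intro linear_conv_bounded_linear[THEN iffD1] linearI)
    (simp_all add: matrix_vector_mult_add_rdistrib scaleR_matrix_vector_assoc)

lemma bounded_linear_fst_apply: "bounded_linear (\<lambda>z :: (real ^ 'n ^ 'm) \<times> 'b::real_normed_vector. fst z *v v)"
  by (rule bounded_linear_compose[OF bounded_linear_matrix_apply bounded_linear_fst])

lemma bounded_linear_fst_snd: "bounded_linear (\<lambda>z. fst (snd z))"
  by (rule bounded_linear_compose[OF bounded_linear_fst bounded_linear_snd])

lemma bounded_linear_snd_snd_inner: "bounded_linear (\<lambda>z. snd (snd z) \<bullet> v)"
  by (rule bounded_linear_compose[OF bounded_linear_inner_left
      bounded_linear_compose[OF bounded_linear_snd bounded_linear_snd]])

lemma bounded_linear_interp:
  "bounded_linear (interp_field x \<theta> i)" "bounded_linear (interp_shift x \<theta> i)"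
  unfolding interp_field_def[abs_def] interp_shift_def[abs_def]
  by (intro bounded_linear_add bounded_linear_const_scaleR bounded_linear_const_mult
      bounded_linear_fst_apply bounded_linear_fst_snd bounded_linear_snd_snd_inner)+

text \<open>The heart of the proof: the derivative in \<open>\<theta>\<close> of the expected log-sum-exp, rewritten by integration by
  parts into minus a sum of products of nonnegative factors.\<close>

lemma interp_drift_nonpos:
  fixes x :: "'i \<Rightarrow> real ^ 'n" and Z :: "'w \<Rightarrow> (real ^ 'n ^ 'm) \<times> (real ^ 'm) \<times> (real ^ 'n)"
  assumes Z: "std_gaussian M Z" and I: "finite I" "I \<noteq> {}" and \<beta>: "\<beta> > 0" and \<epsilon>: "\<epsilon> > 0"
    and s: "s * s = 1" and x: "\<And>i. i \<in> I \<Longrightarrow> norm (x i) = 1"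
    and sin: "sin \<theta> \<ge> 0" and cos: "cos \<theta> \<ge> 0"
  defines "p \<equiv> softmax_model.weight I \<beta> s \<epsilon> (interp_field x \<theta>) (interp_shift x \<theta>)"
    and "g \<equiv> softmax_model.grad \<epsilon> (interp_field x \<theta>)"
  shows "(\<integral>\<omega>. (\<Sum>i\<in>I. p i (Z \<omega>) *
      (s * (g i (Z \<omega>) \<bullet> (cos \<theta> *\<^sub>R (fst (Z \<omega>) *v x i) - sin \<theta> *\<^sub>R fst (snd (Z \<omega>))))
        - sin \<theta> * (snd (snd (Z \<omega>)) \<bullet> x i))) \<partial>M) \<le> 0"
proof -
  interpret softmax_model I \<beta> s \<epsilon>
    "interp_field x \<theta> :: 'i \<Rightarrow> (real ^ 'n ^ 'm) \<times> (real ^ 'm) \<times> (real ^ 'n) \<Rightarrow> _" "interp_shift x \<theta>"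
    by (rule softmax_model.intro[OF I \<beta> \<epsilon> bounded_linear_interp])
  let ?S = "sin \<theta>" and ?C = "cos \<theta>"
  \<comment> \<open>The coefficient vectors of the linear forms in the integrand: \<open>c i k\<close> gives the k-th coordinate of
   \<open>cos \<theta> G x\<^sub>i - sin \<theta> u\<close>, and \<open>d i\<close> gives \<open>h \<bullet> x\<^sub>i\<close>.\<close>
  define c :: "'i \<Rightarrow> 'm \<Rightarrow> (real ^ 'n ^ 'm) \<times> (real ^ 'm) \<times> (real ^ 'n)"
    where "c i k = (axis k (?C *\<^sub>R x i), axis k (- ?S), 0)" for i k
  define d :: "'i \<Rightarrow> (real ^ 'n ^ 'm) \<times> (real ^ 'm) \<times> (real ^ 'n)"
    where "d i = (0, 0, x i)" for i
  let ?e = "\<lambda>k. axis k 1 :: real ^ 'm"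
  have x1: "x i \<bullet> x i = 1" if "i \<in> I" for i using x[OF that] by (simp add: dot_square_norm)
  have zc: "z \<bullet> c i k = (?C *\<^sub>R (fst z *v x i) - ?S *\<^sub>R fst (snd z)) $ k" for z i k
    by (cases z) (simp add: c_def inner_axis matrix_vector_mul_component)
  have zd: "z \<bullet> d i = snd (snd z) \<bullet> x i" for z i
    by (cases z) (simp add: d_def)
  have field_c: "interp_field x \<theta> j (c i k) = axis k (?S * ?C * (x i \<bullet> x j - 1))" for i j k
    by (simp add: vec_eq_iff interp_field_def c_def axis_def matrix_vector_mul_component algebra_simps)
  have shift_c: "interp_shift x \<theta> j (c i k) = 0" for i j k
    by (simp add: interp_shift_def c_def)
  have field_d: "interp_field x \<theta> j (d i) = 0" for i j
    by (simp add: interp_field_def d_def)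
  have shift_d: "interp_shift x \<theta> j (d i) = ?C * (x i \<bullet> x j)" for i j
    by (simp add: interp_shift_def d_def)
  \<comment> \<open>The unit length of \<open>x i\<close> makes \<open>interp_field x \<theta> i\<close> vanish on \<open>c i k\<close>.\<close>
  have c0: "interp_field x \<theta> i (c i k) = 0" if "i \<in> I" for i k
    by (simp add: field_c x1[OF that] axis_def vec_eq_iff)
  note sw = stein_weight[OF Z] and swg = stein_weight_grad[OF Z _ c0]

  have "(\<integral>\<omega>. (\<Sum>i\<in>I. p i (Z \<omega>) *
      (s * (g i (Z \<omega>) \<bullet> (?C *\<^sub>R (fst (Z \<omega>) *v x i) - ?S *\<^sub>R fst (snd (Z \<omega>))))
        - ?S * (snd (snd (Z \<omega>)) \<bullet> x i))) \<partial>M)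
    = (\<integral>\<omega>. (\<Sum>i\<in>I. (\<Sum>k\<in>UNIV. s * ((Z \<omega> \<bullet> c i k) * (weight i (Z \<omega>) * (grad i (Z \<omega>) \<bullet> ?e k))))
        - ?S * ((Z \<omega> \<bullet> d i) * weight i (Z \<omega>))) \<partial>M)"
    unfolding p_def g_def zd zc
    by (intro Bochner_Integration.integral_cong refl sum.cong)
      (simp add: inner_vec_def[of "grad _ _"] inner_axis sum_distrib_left right_diff_distrib ac_simps)
  also have "\<dots> = (\<Sum>i\<in>I. (\<Sum>k\<in>UNIV. s * (\<integral>\<omega>. (Z \<omega> \<bullet> c i k) * (weight i (Z \<omega>) * (grad i (Z \<omega>) \<bullet> ?e k)) \<partial>M))
        - ?S * (\<integral>\<omega>. (Z \<omega> \<bullet> d i) * weight i (Z \<omega>) \<partial>M))"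
    using sw(1) swg(1)
    by (simp add: Bochner_Integration.integral_sum Bochner_Integration.integral_diff)
  also have "\<dots> = (\<Sum>i\<in>I. (\<Sum>k\<in>UNIV. s * (\<integral>\<omega>. weight_deriv i (Z \<omega>) (c i k) * (grad i (Z \<omega>) \<bullet> ?e k) \<partial>M))
        - ?S * (\<integral>\<omega>. weight_deriv i (Z \<omega>) (d i) \<partial>M))"
    using sw(3) swg(3) by simp
  also have "\<dots> = (\<integral>\<omega>. (\<Sum>i\<in>I. (\<Sum>k\<in>UNIV. s * (weight_deriv i (Z \<omega>) (c i k) * (grad i (Z \<omega>) \<bullet> ?e k)))
        - ?S * weight_deriv i (Z \<omega>) (d i)) \<partial>M)"
    using sw(2) swg(2)
    by (simp add: Bochner_Integration.integral_sum Bochner_Integration.integral_diff)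
  also have "\<dots> \<le> (\<integral>\<omega>. 0 \<partial>M)"
  proof (rule integral_mono')
    fix \<omega>
    let ?z = "Z \<omega>"
    let ?P = "\<lambda>i. weight i ?z" and ?g = "\<lambda>i. grad i ?z"
    \<comment> \<open>The directions \<open>c i k\<close> contribute the terms with \<open>(x i \<bullet> x j - 1) * (?g i \<bullet> ?g j)\<close>, the direction \<open>d i\<close>
       those with \<open>1 - x i \<bullet> x j\<close>; their difference factorises.\<close>
    have "(\<Sum>k\<in>UNIV. s * (weight_deriv i ?z (c i k) * (?g i \<bullet> ?e k))) - ?S * weight_deriv i ?z (d i)
        = - (\<beta> * (?S * ?C) * ?P i * (\<Sum>j\<in>I. ?P j * ((1 - x i \<bullet> x j) * (1 - ?g i \<bullet> ?g j))))"
      if i: "i \<in> I" for i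
    proof -
      have "energy_deriv j ?z (c i k) = s * (?S * ?C * (x i \<bullet> x j - 1) * (?g j $ k))" for j k
        by (simp add: energy_deriv_def field_c shift_c inner_axis ac_simps)
      then have "weight_deriv i ?z (c i k)
          = - (\<beta> * ?P i * (\<Sum>j\<in>I. ?P j * (s * (?S * ?C * (x i \<bullet> x j - 1) * (?g j $ k)))))" for k
        using i by (simp add: weight_deriv_def x1)
      then have "(\<Sum>k\<in>UNIV. s * (weight_deriv i ?z (c i k) * (?g i \<bullet> ?e k)))
          = (\<Sum>k\<in>UNIV. \<Sum>j\<in>I. - (s * s * (\<beta> * (?S * ?C) * ?P i * (?P j * ((x i \<bullet> x j - 1) * (?g i $ k * ?g j $ k))))))"
        by (simp add: inner_axis sum_distrib_left sum_distrib_right sum_negf ac_simps)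
      also have "\<dots> = (\<Sum>j\<in>I. - (\<beta> * (?S * ?C) * ?P i * (?P j * ((x i \<bullet> x j - 1) * (?g i \<bullet> ?g j)))))"
        unfolding s by (subst sum.swap) (simp add: inner_vec_def sum_distrib_left sum_negf)
      finally have 1: "(\<Sum>k\<in>UNIV. s * (weight_deriv i ?z (c i k) * (?g i \<bullet> ?e k)))
          = - (\<beta> * (?S * ?C) * ?P i * (\<Sum>j\<in>I. ?P j * ((x i \<bullet> x j - 1) * (?g i \<bullet> ?g j))))"
        by (simp add: sum_distrib_left sum_negf)
      have "energy_deriv j ?z (d i) = ?C * (x i \<bullet> x j)" for j
        by (simp add: energy_deriv_def field_d shift_d)
      then have "weight_deriv i ?z (d i) = \<beta> * ?P i * (?C * (\<Sum>j\<in>I. ?P j) - (\<Sum>j\<in>I. ?P j * (?C * (x i \<bullet> x j))))"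
        using i by (simp add: weight_deriv_def x1 sum_weight)
      also have "\<dots> = \<beta> * ?C * ?P i * (\<Sum>j\<in>I. ?P j * (1 - x i \<bullet> x j))"
        by (simp add: sum_distrib_left sum_subtractf algebra_simps)
      finally have 2: "?S * weight_deriv i ?z (d i) = \<beta> * (?S * ?C) * ?P i * (\<Sum>j\<in>I. ?P j * (1 - x i \<bullet> x j))"
        by simp
      have 3: "(\<Sum>j\<in>I. ?P j * ((x i \<bullet> x j - 1) * (?g i \<bullet> ?g j))) + (\<Sum>j\<in>I. ?P j * (1 - x i \<bullet> x j))
          = (\<Sum>j\<in>I. ?P j * ((1 - x i \<bullet> x j) * (1 - ?g i \<bullet> ?g j)))"
        unfolding sum.distrib[symmetric] by (intro sum.cong refl) (simp add: algebra_simps)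
      show ?thesis
        unfolding 1 2 3[symmetric] by (simp only: distrib_left minus_add_distrib diff_conv_add_uminus)
    qed
    moreover have "0 \<le> \<beta> * (?S * ?C) * ?P i * (\<Sum>j\<in>I. ?P j * ((1 - x i \<bullet> x j) * (1 - ?g i \<bullet> ?g j)))"
      if i: "i \<in> I" for i
    proof -
      have "x i \<bullet> x j \<le> 1" if "j \<in> I" for j
        using norm_cauchy_schwarz[of "x i" "x j"] x[OF i] x[OF that] by simp
      moreover have "?g i \<bullet> ?g j \<le> 1" for j
        using abs_grad_inner_le[of i ?z "?g j"] norm_grad_le_1[of j ?z] by linarith
      ultimately show ?thesis
        using sin cos \<beta> by (intro mult_nonneg_nonneg sum_nonneg weight_bounds) auto
    qed
    ultimately show "(\<Sum>i\<in>I. (\<Sum>k\<in>UNIV. s * (weight_deriv i ?z (c i k) * (?g i \<bullet> ?e k)))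
        - ?S * weight_deriv i ?z (d i)) \<le> 0"
      by (intro sum_nonpos) simp
  qed simp_all
  finally show ?thesis by simp
qed

text \<open>The integrand of \<open>interp_drift_nonpos\<close> is the pathwise derivative of the log-sum-exp, and it is bounded
  by a sum of norms of linear images of the Gaussian vector, uniformly in \<open>\<theta>\<close>.\<close>

lemma smooth_interp_antimono:
  fixes x :: "'i \<Rightarrow> real ^ 'n" and Z :: "'w \<Rightarrow> (real ^ 'n ^ 'm) \<times> (real ^ 'm) \<times> (real ^ 'n)"
  assumes Z: "std_gaussian M Z" and I: "finite I" "I \<noteq> {}" and \<beta>: "\<beta> > 0" and \<epsilon>: "\<epsilon> > 0"
    and s: "s * s = 1" and x: "\<And>i. i \<in> I \<Longrightarrow> norm (x i) = 1"
    and \<theta>: "0 \<le> \<theta>\<^sub>1" "\<theta>\<^sub>1 \<le> \<theta>\<^sub>2" "\<theta>\<^sub>2 \<le> pi / 2"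
  defines "\<Phi> \<equiv> \<lambda>\<theta>. \<integral>\<omega>. log_sum_exp \<beta> I (\<lambda>i. s * smooth_norm \<epsilon> (interp_field x \<theta> i (Z \<omega>)) + interp_shift x \<theta> i (Z \<omega>)) \<partial>M"
  shows "\<Phi> \<theta>\<^sub>2 \<le> \<Phi> \<theta>\<^sub>1"
proof -
  let ?a = "\<lambda>\<theta>. interp_field x \<theta> :: 'i \<Rightarrow> (real ^ 'n ^ 'm) \<times> (real ^ 'm) \<times> (real ^ 'n) \<Rightarrow> _"
  let ?f = "\<lambda>\<theta> \<omega>. log_sum_exp \<beta> I (\<lambda>i. s * smooth_norm \<epsilon> (interp_field x \<theta> i (Z \<omega>)) + interp_shift x \<theta> i (Z \<omega>))"
  let ?p = "\<lambda>\<theta>. softmax_model.weight I \<beta> s \<epsilon> (interp_field x \<theta>) (interp_shift x \<theta>)"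
  let ?g = "\<lambda>\<theta>. softmax_model.grad \<epsilon> (interp_field x \<theta>)"
  let ?e' = "\<lambda>\<theta> i z. s * (?g \<theta> i z \<bullet> (cos \<theta> *\<^sub>R (fst z *v x i) - sin \<theta> *\<^sub>R fst (snd z)))
        - sin \<theta> * (snd (snd z) \<bullet> x i)"
  let ?f' = "\<lambda>\<theta> \<omega>. \<Sum>i\<in>I. ?p \<theta> i (Z \<omega>) * ?e' \<theta> i (Z \<omega>)"
  let ?B = "\<lambda>i z. norm (fst z *v x i) + norm (fst (snd z)) + norm (snd (snd z) \<bullet> x i)"
  have model: "softmax_model I \<beta> \<epsilon> (?a \<theta>) (interp_shift x \<theta>)" for \<theta>
    by (rule softmax_model.intro[OF I \<beta> \<epsilon> bounded_linear_interp])
  have s1: "\<bar>s\<bar> = 1" using s by (metis abs_1 abs_mult_self_eq abs_square_eq_1 power2_eq_square)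
  have "(\<Phi> has_real_derivative (\<integral>\<omega>. ?f' \<theta> \<omega> \<partial>M)) (at \<theta>)" for \<theta>
    unfolding \<Phi>_def
  proof (rule has_real_derivative_integral)
    fix \<theta>
    interpret softmax_model I \<beta> s \<epsilon> "?a \<theta>" "interp_shift x \<theta>" by (rule model)
    show "integrable M (?f \<theta>)"
      using integrable_log_sum_exp[OF Z I \<beta> cont_energy abs_energy_le] by (simp only: energy_def)
  next
    fix \<theta> \<omega>
    interpret softmax_model I \<beta> s \<epsilon> "?a \<theta>" "interp_shift x \<theta>" by (rule model)
    let ?z = "Z \<omega>"
    have w': "((\<lambda>\<theta>. s * smooth_norm \<epsilon> (interp_field x \<theta> i ?z) + interp_shift x \<theta> i ?z) has_derivative
        (\<lambda>h. ?e' \<theta> i ?z * h)) (at \<theta>)" for i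
    proof -
      have "((\<lambda>\<theta>. interp_field x \<theta> i ?z) has_derivative
          (\<lambda>h. h *\<^sub>R (cos \<theta> *\<^sub>R (fst ?z *v x i) - sin \<theta> *\<^sub>R fst (snd ?z)))) (at \<theta>)"
        unfolding interp_field_def by (auto intro!: derivative_eq_intros simp: algebra_simps)
      from has_derivative_compose[OF this smooth_norm_has_derivative[OF \<epsilon>]]
      show ?thesis
        by (auto intro!: derivative_eq_intros simp: interp_shift_def[abs_def] grad_def algebra_simps divide_inverse)
    qed
    have "((\<lambda>\<theta>. ?f \<theta> \<omega>) has_derivative
        (\<lambda>h. \<Sum>i\<in>I. softmax \<beta> I (\<lambda>i. s * smooth_norm \<epsilon> (interp_field x \<theta> i ?z) + interp_shift x \<theta> i ?z) i
          * (?e' \<theta> i ?z * h))) (at \<theta>)"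
      by (rule log_sum_exp_has_derivative[OF I _ w']) (use \<beta> in auto)
    then show "((\<lambda>\<theta>. ?f \<theta> \<omega>) has_real_derivative ?f' \<theta> \<omega>) (at \<theta>)"
      unfolding has_field_derivative_def weight_def energy_def
      by (rule has_derivative_eq_rhs) (auto simp: sum_distrib_right mult.assoc)
    have "\<bar>?e' \<theta> i ?z\<bar> \<le> ?B i ?z" for i
    proof -
      let ?v = "cos \<theta> *\<^sub>R (fst ?z *v x i) - sin \<theta> *\<^sub>R fst (snd ?z)"
      have "norm ?v \<le> \<bar>cos \<theta>\<bar> * norm (fst ?z *v x i) + \<bar>sin \<theta>\<bar> * norm (fst (snd ?z))"
        by (rule order_trans[OF norm_triangle_ineq4]) simp
      also have "\<dots> \<le> 1 * norm (fst ?z *v x i) + 1 * norm (fst (snd ?z))"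
        by (intro add_mono mult_right_mono) auto
      finally have "norm ?v \<le> norm (fst ?z *v x i) + norm (fst (snd ?z))" by simp
      moreover have "\<bar>s * (grad i ?z \<bullet> ?v)\<bar> \<le> norm ?v"
        using abs_grad_inner_le[of i ?z ?v] s1 by (simp add: abs_mult)
      moreover have "\<bar>sin \<theta> * (snd (snd ?z) \<bullet> x i)\<bar> \<le> 1 * \<bar>snd (snd ?z) \<bullet> x i\<bar>"
        unfolding abs_mult by (intro mult_right_mono) auto
      ultimately show ?thesis
        unfolding real_norm_def by linarith
    qed
    then have "\<bar>?p \<theta> i ?z * ?e' \<theta> i ?z\<bar> \<le> 1 * ?B i ?z" if "i \<in> I" for i
      unfolding abs_mult using weight_bounds[of i ?z] that by (intro mult_mono) auto
    then show "\<bar>?f' \<theta> \<omega>\<bar> \<le> (\<Sum>i\<in>I. ?B i ?z)"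
      by (intro order_trans[OF sum_abs] sum_mono) simp
  next
    show "integrable M (\<lambda>\<omega>. \<Sum>i\<in>I. ?B i (Z \<omega>))"
      by (intro Bochner_Integration.integrable_sum Bochner_Integration.integrable_add
          std_gaussian_integrable_norm_linear[OF Z] bounded_linear_fst_apply bounded_linear_fst_snd
          bounded_linear_snd_snd_inner)
  qed
  moreover have "(\<integral>\<omega>. ?f' \<theta> \<omega> \<partial>M) \<le> 0" if "\<theta> \<in> {\<theta>\<^sub>1..\<theta>\<^sub>2}" for \<theta>
    by (rule interp_drift_nonpos[OF Z I \<beta> \<epsilon> s x])
      (use that \<theta> in \<open>auto intro!: sin_ge_zero cos_ge_zero\<close>)
  ultimately show ?thesis
    by (intro deriv_nonpos_imp_antimono[of \<theta>\<^sub>1 \<theta>\<^sub>2 \<Phi>]) (use \<theta> in auto)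
qed


text \<open>Replacing the norm by its smoothing changes the expectation by at most \<open>\<epsilon>\<close>, uniformly in \<open>\<theta>\<close>.\<close>

lemma interp_antimono:
  fixes x :: "'i \<Rightarrow> real ^ 'n" and Z :: "'w \<Rightarrow> (real ^ 'n ^ 'm) \<times> (real ^ 'm) \<times> (real ^ 'n)"
  assumes Z: "std_gaussian M Z" and I: "finite I" "I \<noteq> {}" and \<beta>: "\<beta> > 0"
    and s: "s * s = 1" and x: "\<And>i. i \<in> I \<Longrightarrow> norm (x i) = 1"
    and \<theta>: "0 \<le> \<theta>\<^sub>1" "\<theta>\<^sub>1 \<le> \<theta>\<^sub>2" "\<theta>\<^sub>2 \<le> pi / 2"
  defines "\<Phi> \<equiv> \<lambda>\<theta>. \<integral>\<omega>. log_sum_exp \<beta> I (\<lambda>i. s * norm (interp_field x \<theta> i (Z \<omega>)) + interp_shift x \<theta> i (Z \<omega>)) \<partial>M"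
  shows "\<Phi> \<theta>\<^sub>2 \<le> \<Phi> \<theta>\<^sub>1"
proof (rule field_le_epsilon)
  fix e :: real assume "e > 0"
  \<comment> \<open>Two comparisons, one at each endpoint, cost \<open>\<epsilon>\<close> each.\<close>
  define \<epsilon> where "\<epsilon> = e / 2"
  have \<epsilon>: "\<epsilon> > 0" using \<open>e > 0\<close> by (simp add: \<epsilon>_def)
  interpret prob_space M using Z by (simp add: std_gaussian_def)
  let ?a = "\<lambda>\<theta>. interp_field x \<theta> :: 'i \<Rightarrow> (real ^ 'n ^ 'm) \<times> (real ^ 'm) \<times> (real ^ 'n) \<Rightarrow> _"
  let ?w = "\<lambda>\<theta> i z. s * norm (?a \<theta> i z) + interp_shift x \<theta> i z"
  let ?v = "\<lambda>\<theta> i z. s * smooth_norm \<epsilon> (?a \<theta> i z) + interp_shift x \<theta> i z"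
  let ?\<Psi> = "\<lambda>\<theta>. \<integral>\<omega>. log_sum_exp \<beta> I (\<lambda>i. ?v \<theta> i (Z \<omega>)) \<partial>M"
  have s1: "\<bar>s\<bar> = 1" using s by (metis abs_1 abs_mult_self_eq abs_square_eq_1 power2_eq_square)
  have close: "\<bar>\<Phi> \<theta> - ?\<Psi> \<theta>\<bar> \<le> \<epsilon>" for \<theta>
  proof -
    interpret softmax_model I \<beta> s \<epsilon> "?a \<theta>" "interp_shift x \<theta>"
      by (rule softmax_model.intro[OF I \<beta> \<epsilon> bounded_linear_interp])
    have near: "\<bar>?w \<theta> i z - ?v \<theta> i z\<bar> \<le> \<epsilon>" for i z
    proof -
      have "\<bar>?w \<theta> i z - ?v \<theta> i z\<bar> = \<bar>s\<bar> * \<bar>norm (?a \<theta> i z) - smooth_norm \<epsilon> (?a \<theta> i z)\<bar>"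
        by (simp flip: abs_mult right_diff_distrib)
      then show ?thesis
        using norm_le_smooth_norm[of "?a \<theta> i z" \<epsilon>] smooth_norm_le[of \<epsilon> "?a \<theta> i z"] \<epsilon> s1 by simp
    qed
    have v: "integrable M (\<lambda>\<omega>. log_sum_exp \<beta> I (\<lambda>i. ?v \<theta> i (Z \<omega>)))"
      using integrable_log_sum_exp[OF Z I \<beta> cont_energy abs_energy_le] by (simp only: energy_def)
    have w: "integrable M (\<lambda>\<omega>. log_sum_exp \<beta> I (\<lambda>i. ?w \<theta> i (Z \<omega>)))"
    proof (rule integrable_log_sum_exp[OF Z I \<beta>, of "?w \<theta>" "2 * \<epsilon>" lip])
      show "continuous_on UNIV (?w \<theta> i)" for i
        by (intro continuous_intros cont_a bounded_linear.continuous_on[OF b])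
      show "\<bar>?w \<theta> i z\<bar> \<le> 2 * \<epsilon> + lip * norm z" if "i \<in> I" for i z
        using abs_energy_le[OF that, of z] near[of i z] s1 unfolding energy_def by simp
    qed
    have "\<bar>\<Phi> \<theta> - ?\<Psi> \<theta>\<bar>
        = \<bar>\<integral>\<omega>. log_sum_exp \<beta> I (\<lambda>i. ?w \<theta> i (Z \<omega>)) - log_sum_exp \<beta> I (\<lambda>i. ?v \<theta> i (Z \<omega>)) \<partial>M\<bar>"
      unfolding \<Phi>_def using v w by simp
    also have "\<dots> \<le> (\<integral>\<omega>. \<bar>log_sum_exp \<beta> I (\<lambda>i. ?w \<theta> i (Z \<omega>)) - log_sum_exp \<beta> I (\<lambda>i. ?v \<theta> i (Z \<omega>))\<bar> \<partial>M)"
      by (rule integral_abs_bound)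
    also have "\<dots> \<le> (\<integral>\<omega>. \<epsilon> \<partial>M)"
      using v w near by (intro integral_mono log_sum_exp_nonexpansive I \<beta>) auto
    finally show ?thesis by (simp add: prob_space)
  qed
  have "?\<Psi> \<theta>\<^sub>2 \<le> ?\<Psi> \<theta>\<^sub>1"
    by (rule smooth_interp_antimono[OF Z I \<beta> \<epsilon> s x \<theta>])
  then have "\<Phi> \<theta>\<^sub>2 \<le> \<Phi> \<theta>\<^sub>1 + 2 * \<epsilon>" using close[of \<theta>\<^sub>1] close[of \<theta>\<^sub>2] by linarith
  then show "\<Phi> \<theta>\<^sub>2 \<le> \<Phi> \<theta>\<^sub>1 + e" by (simp add: \<epsilon>_def)
qed


theorem theorem1:
  fixes M :: "'w measure"
    and G :: "'w \<Rightarrow> real ^ 'n ^ 'm"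
    and u :: "'w \<Rightarrow> real ^ 'm"
    and h :: "'w \<Rightarrow> real ^ 'n"
    and l :: nat
    and x :: "nat \<Rightarrow> real ^ 'n"
    and \<beta> s :: real
  assumes "prob_space M"
    and "iid_std_normal M (\<lambda>(i, j) \<omega>. G \<omega> $ i $ j) UNIV"
    and "iid_std_normal M (\<lambda>i \<omega>. u \<omega> $ i) UNIV"
    and "iid_std_normal M (\<lambda>j \<omega>. h \<omega> $ j) UNIV"
    and "indep_three M G u h"
    and "l \<ge> 1"
    and "\<And>i. i \<in> {1..l} \<Longrightarrow> x i \<in> sphere 0 1"
    and "\<beta> > 0"
    and "s \<in> {-1, 1}"
  shows "antimono_on {0..1} (\<lambda>t. psi M G u h l x \<beta> s t)"
proof (rule monotone_onI)
  fix t\<^sub>1 t\<^sub>2 :: real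
  assume t: "t\<^sub>1 \<in> {0..1}" "t\<^sub>2 \<in> {0..1}" "t\<^sub>1 \<le> t\<^sub>2"
  define Z where "Z \<omega> = (G \<omega>, u \<omega>, h \<omega>)" for \<omega>
  have Z: "std_gaussian M Z"
    unfolding Z_def using assms(1-5) by (intro std_gaussian_triple std_gaussian_matrix std_gaussian_vec)
  define \<Phi> where "\<Phi> \<theta> = (\<integral>\<omega>. log_sum_exp \<beta> {1..l}
      (\<lambda>i. s * norm (interp_field x \<theta> i (Z \<omega>)) + interp_shift x \<theta> i (Z \<omega>)) \<partial>M)" for \<theta>
  have psi: "psi M G u h l x \<beta> s t = \<Phi> (arcsin (sqrt t)) / sqrt (real CARD('n))" if "t \<in> {0..1}" for t
  proof -
    have "-1 \<le> sqrt t" "sqrt t \<le> 1"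
      using that by (auto intro: order_trans[OF _ real_sqrt_ge_zero])
    then have "sin (arcsin (sqrt t)) = sqrt t" "cos (arcsin (sqrt t)) = sqrt (1 - t)"
      using that by (auto simp: cos_arcsin)
    then show ?thesis
      unfolding psi_def \<Phi>_def by (simp add: log_sum_exp_def interp_field_def interp_shift_def Z_def)
  qed
  have "\<Phi> (arcsin (sqrt t\<^sub>2)) \<le> \<Phi> (arcsin (sqrt t\<^sub>1))"
    unfolding \<Phi>_def
  proof (rule interp_antimono[OF Z])
    have b: "0 \<le> sqrt t\<^sub>1" "sqrt t\<^sub>1 \<le> sqrt t\<^sub>2" "sqrt t\<^sub>2 \<le> 1" using t by auto
    have "arcsin 0 \<le> arcsin (sqrt t\<^sub>1)"
      by (rule arcsin_le_arcsin; use b in linarith)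
    then show "0 \<le> arcsin (sqrt t\<^sub>1)" by simp
    show "arcsin (sqrt t\<^sub>1) \<le> arcsin (sqrt t\<^sub>2)"
      by (rule arcsin_le_arcsin; use b in linarith)
    show "arcsin (sqrt t\<^sub>2) \<le> pi / 2"
      by (rule arcsin_ubound; use b in linarith)
  qed (use assms in auto)
  then show "psi M G u h l x \<beta> s t\<^sub>2 \<le> psi M G u h l x \<beta> s t\<^sub>1"
    unfolding psi[OF t(1)] psi[OF t(2)] by (intro divide_right_mono) auto
qed

end
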